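(* Let $L\in\{1,\infty\}$, $0<p,r\le\infty$, $b\in SV(0,L)$ be such that the Lorentz–Karamata space $L_{p,r;b}(0,L)$ is non-trivial (i.e. $\ne\{0\}$). Let $0<W<\infty$, $0<U<\infty$, $0<V\le\infty$. Then: (i) $\|f\|_{p,r;b}\sim\|H^{(U,W)}f\|_{B_{p,r;b}}$ for all $f\in\mathfrak M(0,L)$ if and only if $p>U$. (ii) $\|f\|_{p,r;b}\sim\|H_{(V,W)}f\|_{B_{p,r;b}}$ for all $f\in\mathfrak M(0,L)$ if and only if $p<V$.
   Context: Conventions: $1/\infty=0$. $\mathfrak M(0,L)$ is the set of complex-valued Lebesgue measurable a.e. finite functions on $(0,L)$ (identified if equal a.e.). For $0<q\le\infty$, $\|\cdot\|_{q,(a,b)}$ is the usual Lebesgue (quasi-)norm on $(a,b)$ (essential supremum if $q=\infty$). $f^*(t)=\inf\{\lambda>0:\ |\{x\in(0,L):|f(x)|>\lambda\}|\le t\}$ is the non-increasing rearrangement. $F\sim G$ means $c\,G\le F\le C\,G$ with constants $0<c\le C<\infty$ independent of $f$ (both sides may be $\infty$). $SV=SV(0,L)$: positive measurable $b$ on $(0,L)$ such that for every $\varepsilon>0$ the function $t^{\varepsilon}b(t)$ is equivalent ($\sim$, pointwise with constants) to a non-decreasing function and $t^{-\varepsilon}b(t)$ is equivalent to a non-increasing function. $\|g\|_{B_{p,r;b}}=\big\|t^{\frac1p-\frac1r}b(t)|g(t)|\big\|_{r,(0,L)}$ for measurable $g$ on $(0,L)$ (possibly with value $\infty$), and $L_{p,r;b}(0,L)$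 is the set of $f\in\mathfrak M(0,L)$ with $\|f\|_{p,r;b}:=\|f^*\|_{B_{p,r;b}}<\infty$. (It is known that it is non-trivial iff $p<\infty$, or $p=\infty$ and $\|t^{-1/r}b(t)\|_{r,(0,1)}<\infty$.) Averaging operators, for $f\in\mathfrak M(0,L)$, $t\in(0,L)$: $$(H^{(U,W)}f)(t)=t^{-1/U}\big\|v^{\frac1U-\frac1W}f^*(v)\big\|_{W,(0,t)},\qquad (H_{(V,W)}f)(t)=t^{-1/V}\big\|v^{\frac1V-\frac1W}f^*(v)\big\|_{W,(t,L)}.$$ *)

theory Defs
  imports "HOL-Analysis.Analysis" "HOL-Probability.Essential_Supremum"
begin

definition ival :: "ennreal \<Rightarrow> real set" where
  "ival L = {t. 0 < t \<and> ennreal t < L}"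

definition recip :: "ennreal \<Rightarrow> real" where
  "recip p = enn2real (1 / p)"

text \<open>The conventions on inverses in \<^typ>\<open>ennreal\<close> give the value 0 for an infinite exponent.\<close>

lemma recip_top: "recip \<infinity> = 0"
  by (simp add: recip_def)

lemma recip_ennreal: "0 < x \<Longrightarrow> recip (ennreal x) = 1 / x"
  by (simp add: recip_def divide_ennreal flip: ennreal_1)

text \<open>Powers with a positive real exponent; only used for \<open>a > 0\<close>.\<close>

definition epow :: "ennreal \<Rightarrow> real \<Rightarrow> ennreal" where
  "epow x a = (if x = \<infinity> then \<infinity> else ennreal (enn2real x powr a))"

text \<open>The Lebesgue (quasi-)norm over \<open>A\<close> of a nonnegative function with values in \<open>[0, \<infinity>]\<close>;
  signed or complex functions enter through their absolute value.\<close>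

definition Lq_norm :: "ennreal \<Rightarrow> real set \<Rightarrow> (real \<Rightarrow> ennreal) \<Rightarrow> ennreal" where
  "Lq_norm q A g =
     (if q = \<infinity> then esssup (lebesgue_on A) g
      else epow (\<integral>\<^sup>+ x. epow (g x) (enn2real q) \<partial>lebesgue_on A) (recip q))"

text \<open>Functions are not identified when equal almost everywhere. A function that is finite almost
  everywhere has a representative with values in the complex numbers.\<close>

definition meas_fun :: "ennreal \<Rightarrow> (real \<Rightarrow> complex) set" where
  "meas_fun L = borel_measurable (lebesgue_on (ival L))"

text \<open>The infimum of the empty set is \<open>\<infinity>\<close>.\<close>

definition rearr :: "ennreal \<Rightarrow> (real \<Rightarrow> complex) \<Rightarrow> real \<Rightarrow> ennreal" where
  "rearr L f t =
     Inf {ennreal l | l. 0 < l \<and> emeasure lebesgue {x \<in> ival L. l < cmod (f x)} \<le> ennreal t}"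

definition SV :: "ennreal \<Rightarrow> (real \<Rightarrow> real) set" where
  "SV L = {b \<in> borel_measurable (lebesgue_on (ival L)).
     (\<forall>t\<in>ival L. 0 < b t) \<and>
     (\<forall>\<epsilon>>0.
       (\<exists>h c C. 0 < c \<and> 0 < C \<and> mono_on (ival L) h \<and>
          (\<forall>t\<in>ival L. c * h t \<le> t powr \<epsilon> * b t \<and> t powr \<epsilon> * b t \<le> C * h t)) \<and>
       (\<exists>h c C. 0 < c \<and> 0 < C \<and> antimono_on (ival L) h \<and>
          (\<forall>t\<in>ival L. c * h t \<le> t powr (- \<epsilon>) * b t \<and> t powr (- \<epsilon>) * b t \<le> C * h t)))}"

definition B_norm ::
  "ennreal \<Rightarrow> ennreal \<Rightarrow> ennreal \<Rightarrow> (real \<Rightarrow> real) \<Rightarrow> (real \<Rightarrow> ennreal) \<Rightarrow> ennreal" where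
  "B_norm L p r b g =
     Lq_norm r (ival L) (\<lambda>t. ennreal (t powr (recip p - recip r) * b t) * g t)"

definition LK_norm ::
  "ennreal \<Rightarrow> ennreal \<Rightarrow> ennreal \<Rightarrow> (real \<Rightarrow> real) \<Rightarrow> (real \<Rightarrow> complex) \<Rightarrow> ennreal" where
  "LK_norm L p r b f = B_norm L p r b (rearr L f)"

definition LK_space ::
  "ennreal \<Rightarrow> ennreal \<Rightarrow> ennreal \<Rightarrow> (real \<Rightarrow> real) \<Rightarrow> (real \<Rightarrow> complex) set" where
  "LK_space L p r b = {f \<in> meas_fun L. LK_norm L p r b f < \<infinity>}"

definition nontrivial_space :: "ennreal \<Rightarrow> (real \<Rightarrow> complex) set \<Rightarrow> bool" where
  "nontrivial_space L X \<longleftrightarrow> (\<exists>f\<in>X. \<not> (AE x in lebesgue_on (ival L). f x = 0))"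

definition H_upper ::
  "ennreal \<Rightarrow> ennreal \<Rightarrow> ennreal \<Rightarrow> (real \<Rightarrow> complex) \<Rightarrow> real \<Rightarrow> ennreal" where
  "H_upper L U W f t =
     ennreal (t powr (- recip U)) *
     Lq_norm W {0<..<t} (\<lambda>v. ennreal (v powr (recip U - recip W)) * rearr L f v)"

definition H_lower ::
  "ennreal \<Rightarrow> ennreal \<Rightarrow> ennreal \<Rightarrow> (real \<Rightarrow> complex) \<Rightarrow> real \<Rightarrow> ennreal" where
  "H_lower L V W f t =
     ennreal (t powr (- recip V)) *
     Lq_norm W (ival L \<inter> {t<..}) (\<lambda>v. ennreal (v powr (recip V - recip W)) * rearr L f v)"

definition equiv_on :: "'a set \<Rightarrow> ('a \<Rightarrow> ennreal) \<Rightarrow> ('a \<Rightarrow> ennreal) \<Rightarrow> bool" where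
  "equiv_on X F G \<longleftrightarrow>
     (\<exists>c C :: real. 0 < c \<and> c \<le> C \<and>
        (\<forall>f\<in>X. ennreal c * G f \<le> F f \<and> F f \<le> ennreal C * G f))"

end

theory Submission
  imports Defs
begin

text \<open>
  The upper bounds are Hardy inequalities. For a non-increasing \<open>F\<close>, the value \<open>F(v)\<close> to the power \<open>\<rho>\<close>
  is controlled by the integral of \<open>F\<close> to the power \<open>\<rho>\<close> over \<open>(v/2, v)\<close>. For an exponent \<open>\<kappa>\<close> strictly
  between \<open>1/p\<close> and the reciprocal of the outer exponent, this bounds an average of inner exponent \<open>W\<close>
  at \<open>t\<close> by \<open>t\<close> to the power \<open>-\<kappa>\<close> times a weighted norm of \<open>F\<close> of exponent \<open>r\<close>, whichever of
  \<open>r\<close> and \<open>W\<close> is larger; Tonelli and slow variation of \<open>b\<close> then finish the estimate. Conversely, monotonicity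
  bounds the upper average at \<open>t\<close> from below by \<open>F(t)\<close> and the lower average by \<open>F(2t)\<close>, up to constants.

  When the condition on the exponents fails, power functions are almost eigenfunctions of the averages.
  With \<open>f(x) = x\<close> to the power \<open>\<delta> - 1/U\<close> on \<open>(0, 1)\<close>, the upper average multiplies \<open>f\<close> by a constant of
  order \<open>\<delta>\<close> to the power \<open>-1/W\<close>. With \<open>f(x) = max s x\<close> to the power \<open>-(1/V + \<delta>)\<close> on \<open>(0, 1)\<close>, the lower
  average has the same effect on some \<open>(0, \<tau>)\<close> that does not depend on \<open>s\<close>, and the part of \<open>f\<close> beyond \<open>\<tau>\<close>
  is negligible in norm as \<open>s \<rightarrow> 0\<close>.
\<close>

section \<open>Powers in the extended half-line, measurability and kernels\<close>

text \<open>The bounds from below hold for all exponents, so the two conditions are decided by the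
  bounds from above alone. For these, Minkowski's inequality would cover only
  \<open>W \<le> r\<close>. Monotonicity removes the distinction: on the whole range of integration
  it puts \<open>F\<close> below a single power \<open>v powr (- \<kappa>)\<close> times a factor
  free of \<open>v\<close>, and the inner integral of that power is explicit. The strict inequality
  between the exponents is spent in three portions when \<open>r\<close> is finite: one makes the
  inner integral converge, one absorbs \<open>b\<close>, one makes the outer integral converge.
  These estimates live in \<open>ennreal\<close>, where infinite norms need no separate treatment.
  The counterexamples are different: they end in \<open>N \<le> N / 2\<close>, a contradiction only
  if the norm is neither 0 nor infinite. For the lower average the pure power has infinite norm,
  which forces the cut at \<open>s\<close>; what then remains to be finite is the norm of the
  indicator of (0, 1), and this is where nontriviality of the space enters.\<close>

lemma epow_mono: "x \<le> y \<Longrightarrow> 0 < a \<Longrightarrow> epow x a \<le> epow y a"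
  by (cases x; cases y) (auto simp: epow_def top_unique intro!: powr_mono2)

lemma epow_ennreal: "0 \<le> x \<Longrightarrow> epow (ennreal x) a = ennreal (x powr a)"
  by (simp add: epow_def)

lemma epow_0 [simp]: "epow 0 a = 0"
  by (simp add: epow_def)

lemma epow_top [simp]: "epow top a = top"
  by (simp add: epow_def)

lemma epow_eq_0_iff [simp]: "epow x a = 0 \<longleftrightarrow> x = 0"
  by (cases x) (auto simp: epow_def ennreal_eq_0_iff)

lemma epow_eq_top_iff [simp]: "epow x a = top \<longleftrightarrow> x = top"
  by (auto simp: epow_def)

text \<open>Since \<open>epow\<close> sends 0 to 0 and infinity to infinity for every exponent, the
  convention that 0 times infinity is 0 is respected on both sides.\<close>

lemma epow_mult: "epow (x * y) a = epow x a * epow y a"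
proof (cases "x = top \<or> y = top")
  case True
  then show ?thesis
    by (cases "x = 0"; cases "y = 0") (auto simp: ennreal_mult_eq_top_iff ennreal_top_mult ennreal_mult_top)
next
  case False
  then obtain r s where "x = ennreal r" "y = ennreal s" "0 \<le> r" "0 \<le> s"
    by (metis ennreal_cases)
  then show ?thesis
    by (simp add: epow_ennreal powr_mult flip: ennreal_mult)
qed

lemma epow_epow: "epow (epow x a) c = epow x (a * c)"
  by (cases x) (auto simp: epow_ennreal powr_powr)

lemma epow_one [simp]: "epow x 1 = x"
  by (cases x) (auto simp: epow_ennreal)

lemma epow_inverse: "0 < a \<Longrightarrow> epow (epow x a) (1 / a) = x" "0 < a \<Longrightarrow> epow (epow x (1 / a)) a = x"
  by (simp_all add: epow_epow)

lemma epow_le_imp: "epow x a \<le> y \<Longrightarrow> 0 < a \<Longrightarrow> x \<le> epow y (1 / a)"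
  using epow_mono[of "epow x a" y "1 / a"] by (simp add: epow_inverse)

lemma measurable_epow [measurable]: "(\<lambda>x. epow x a) \<in> borel_measurable borel"
  unfolding epow_def by measurable

lemma borel_measurable_epow [measurable (raw)]:
  "f \<in> borel_measurable M \<Longrightarrow> (\<lambda>x. epow (f x) a) \<in> borel_measurable M"
  by (rule measurable_compose[OF _ measurable_epow])

lemma recip_nonneg: "0 \<le> recip p"
  by (simp add: recip_def)

lemma recip_pos: "0 < p \<Longrightarrow> p < \<infinity> \<Longrightarrow> 0 < recip p"
  by (cases p) (auto simp: recip_ennreal)

text \<open>Turns the conditions on exponents into inequalities between real numbers; infinite
  exponents are included, with reciprocal 0.\<close>

lemma recip_less_iff: "0 < p \<Longrightarrow> 0 < q \<Longrightarrow> recip q < recip p \<longleftrightarrow> p < q"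
  by (cases p; cases q) (auto simp: recip_ennreal recip_top[simplified] frac_less2 divide_strict_left_mono
      ennreal_less_iff divide_less_cancel field_simps)

text \<open>Superlevel sets of a monotone function are intervals. Rearrangements, and the integrals
  inside the averages as functions of \<open>t\<close>, get their measurability from monotonicity in
  this way.\<close>

lemma borel_measurable_mono_ennreal:
  fixes f :: "real \<Rightarrow> ennreal"
  assumes "mono f"
  shows "f \<in> borel_measurable borel"
proof (rule borel_measurableI_greater)
  fix y
  have "is_interval {x. y < f x}"
    unfolding is_interval_1 using assms by (auto simp: mono_def intro: less_le_trans)
  then show "{x \<in> space borel. y < f x} \<in> sets borel"
    by (simp add: real_interval_borel_measurable)
qed

lemma borel_measurable_antimono_ennreal:
  fixes f :: "real \<Rightarrow> ennreal"
  assumes "antimono f"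
  shows "f \<in> borel_measurable borel"
proof -
  have "mono (\<lambda>x. f (- x))"
    using assms by (auto simp: mono_def antimono_def)
  then have "(\<lambda>x. f (- x)) \<in> borel_measurable borel"
    by (rule borel_measurable_mono_ennreal)
  then have "(\<lambda>x. f (- (- x))) \<in> borel_measurable borel"
    by (rule measurable_compose[rotated]) simp
  then show ?thesis by simp
qed

section \<open>The interval (0, L) and Lebesgue measure\<close>

lemma ival_borel [measurable]: "ival L \<in> sets borel"
  unfolding ival_def by measurable

lemma ival_lebesgue [simp]: "ival L \<in> sets lebesgue"
  using sets_completionI_sets[of "ival L" lborel] by simp

lemma ival_down: "t \<in> ival L \<Longrightarrow> 0 < s \<Longrightarrow> s \<le> t \<Longrightarrow> s \<in> ival L"
  unfolding ival_def by (auto intro: le_less_trans ennreal_leI)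

lemma ival_pos: "t \<in> ival L \<Longrightarrow> 0 < t"
  by (simp add: ival_def)

lemma unit_subset_ival: "1 \<le> L \<Longrightarrow> {0<..<1} \<subseteq> ival L"
  unfolding ival_def by (auto intro!: less_le_trans[of _ 1 L] simp: ennreal_less_one_iff)

lemma ival_upper_nbhd:
  assumes "t \<in> ival L"
  obtains d where "0 < d" "{t..<t + d} \<subseteq> ival L"
proof (cases L)
  case (real l)
  show ?thesis
    by (rule that[of "l - t"]) (use assms real in \<open>auto simp: ival_def ennreal_less_iff\<close>)
next
  case top
  show ?thesis
    by (rule that[of 1]) (use assms top in \<open>auto simp: ival_def\<close>)
qed

lemma borel_imp_lebesgue_measurable: "f \<in> borel_measurable borel \<Longrightarrow> f \<in> borel_measurable lebesgue"
  by (simp add: measurable_completion)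

text \<open>Tonelli is applied to the completed measure, because \<open>b\<close> is only Lebesgue
  measurable. A countable cover by Borel sets of finite measure for \<open>lborel\<close> serves the
  completion as well.\<close>

lemma sigma_finite_lebesgue: "sigma_finite_measure (lebesgue :: real measure)"
proof
  obtain A :: "nat \<Rightarrow> real set"
    where A: "range A \<subseteq> sets lborel" "(\<Union>i. A i) = space lborel" "\<And>i. emeasure lborel (A i) \<noteq> \<infinity>"
    by (meson lborel.sigma_finite)
  show "\<exists>A. countable A \<and> A \<subseteq> sets (lebesgue :: real measure) \<and> \<Union>A = space lebesgue
      \<and> (\<forall>a\<in>A. emeasure lebesgue a \<noteq> \<infinity>)"
  proof (rule exI[of _ "range A"], intro conjI ballI)
    show "range A \<subseteq> sets lebesgue"
      using A(1) by (auto intro: sets_completionI_sets)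
    show "\<Union>(range A) = space lebesgue"
      using A(2) by simp
    fix a assume "a \<in> range A"
    then show "emeasure lebesgue a \<noteq> \<infinity>"
      using A by (auto simp: emeasure_completion[of "A _" lborel])
  qed auto
qed

text \<open>A Schur-type test: insert the pointwise bound on \<open>g\<close>, exchange the
  integrals, and apply the bound on the transposed kernel acting on the weight \<open>A\<close>. It
  yields both the Hardy inequalities and the comparison of a function with its dilation.\<close>

lemma kernel_integral_le:
  fixes A B :: "real \<Rightarrow> ennreal" and k :: "real \<Rightarrow> real \<Rightarrow> ennreal" and S :: "real set"
  assumes [measurable]: "S \<in> sets lebesgue"
    "(\<lambda>t. A t * indicator S t) \<in> borel_measurable lebesgue"
    "(\<lambda>t. B t * indicator S t) \<in> borel_measurable lebesgue"
    "(\<lambda>t. D t * indicator S t) \<in> borel_measurable lebesgue"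
    "(\<lambda>(t, u). k t u) \<in> borel_measurable (borel \<Otimes>\<^sub>M borel)"
    and g: "\<And>t. t \<in> S \<Longrightarrow> g t \<le> (\<integral>\<^sup>+u\<in>S. k t u * B u \<partial>lebesgue)"
    and D: "\<And>u. u \<in> S \<Longrightarrow> (\<integral>\<^sup>+t\<in>S. A t * k t u \<partial>lebesgue) \<le> K * D u"
  shows "(\<integral>\<^sup>+t\<in>S. A t * g t \<partial>lebesgue) \<le> K * (\<integral>\<^sup>+u\<in>S. D u * B u \<partial>lebesgue)"
proof -
  interpret sigma_finite_measure "lebesgue :: real measure" by (rule sigma_finite_lebesgue)
  interpret pair_sigma_finite "lebesgue :: real measure" "lebesgue :: real measure" ..
  define A' where "A' = (\<lambda>t. A t * indicator S t)"
  define B' where "B' = (\<lambda>t. B t * indicator S t)"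
  define D' where "D' = (\<lambda>t. D t * indicator S t)"
  have [measurable]: "A' \<in> borel_measurable lebesgue" "B' \<in> borel_measurable lebesgue" "D' \<in> borel_measurable lebesgue"
    unfolding A'_def B'_def D'_def by measurable
  \<comment> \<open>The kernel is Borel on the plane. Pulling it back along the identity makes it
    measurable for the product of the completed measures.\<close>
  have id: "(\<lambda>x. x) \<in> lebesgue \<rightarrow>\<^sub>M (borel :: real measure)"
    by (rule borel_imp_lebesgue_measurable) simp
  have k2 [measurable]: "(\<lambda>x. k (fst x) (snd x)) \<in> borel_measurable (lebesgue \<Otimes>\<^sub>M lebesgue)"
  proof -
    have "(\<lambda>x. (fst x, snd x)) \<in> (lebesgue \<Otimes>\<^sub>M lebesgue) \<rightarrow>\<^sub>M ((borel :: real measure) \<Otimes>\<^sub>M (borel :: real measure))"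
      by (intro measurable_Pair measurable_compose[OF measurable_fst id] measurable_compose[OF measurable_snd id])
    from measurable_compose[OF this assms(5)] show ?thesis by simp
  qed
  have k1 [measurable]: "(\<lambda>u. k t u) \<in> borel_measurable lebesgue" for t
    using assms(5) by (intro borel_imp_lebesgue_measurable) (auto intro: measurable_compose[OF measurable_Pair1'])
  have k3 [measurable]: "(\<lambda>t. k t u) \<in> borel_measurable lebesgue" for u
    using assms(5) by (intro borel_imp_lebesgue_measurable) (auto intro: measurable_compose[OF measurable_Pair2'])
  have "(\<integral>\<^sup>+t\<in>S. A t * g t \<partial>lebesgue) \<le> (\<integral>\<^sup>+t. (\<integral>\<^sup>+u. A' t * (k t u * B' u) \<partial>lebesgue) \<partial>lebesgue)"
  proof (rule nn_integral_mono)
    fix t :: real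
    have "(\<integral>\<^sup>+u. A' t * (k t u * B' u) \<partial>lebesgue) = A' t * (\<integral>\<^sup>+u. k t u * B' u \<partial>lebesgue)"
      by (rule nn_integral_cmult) measurable
    also have "(\<integral>\<^sup>+u. k t u * B' u \<partial>lebesgue) = (\<integral>\<^sup>+u\<in>S. k t u * B u \<partial>lebesgue)"
      by (simp add: B'_def mult.assoc)
    finally show "A t * g t * indicator S t \<le> (\<integral>\<^sup>+u. A' t * (k t u * B' u) \<partial>lebesgue)"
      using g[of t] by (auto simp: A'_def indicator_def intro: mult_left_mono)
  qed
  also have "\<dots> = (\<integral>\<^sup>+u. (\<integral>\<^sup>+t. A' t * (k t u * B' u) \<partial>lebesgue) \<partial>lebesgue)"
    by (subst Fubini') (auto simp: split_beta')
  also have "\<dots> \<le> (\<integral>\<^sup>+u. K * (D' u * B' u) \<partial>lebesgue)"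
  proof (rule nn_integral_mono)
    fix u :: real
    have "(\<integral>\<^sup>+t. A' t * (k t u * B' u) \<partial>lebesgue) = (\<integral>\<^sup>+t. (A' t * k t u) * B' u \<partial>lebesgue)"
      by (simp add: mult.assoc)
    also have "\<dots> = (\<integral>\<^sup>+t. A' t * k t u \<partial>lebesgue) * B' u"
      by (rule nn_integral_multc) measurable
    also have "(\<integral>\<^sup>+t. A' t * k t u \<partial>lebesgue) = (\<integral>\<^sup>+t\<in>S. A t * k t u \<partial>lebesgue)"
      by (intro nn_integral_cong) (auto simp: A'_def ac_simps)
    finally show "(\<integral>\<^sup>+t. A' t * (k t u * B' u) \<partial>lebesgue) \<le> K * (D' u * B' u)"
      using D[of u] by (auto simp: B'_def D'_def indicator_def mult.assoc[symmetric] intro: mult_right_mono)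
  qed
  also have "\<dots> = K * (\<integral>\<^sup>+u. D' u * B' u \<partial>lebesgue)"
    by (rule nn_integral_cmult) measurable
  also have "(\<integral>\<^sup>+u. D' u * B' u \<partial>lebesgue) = (\<integral>\<^sup>+u\<in>S. D u * B u \<partial>lebesgue)"
    by (intro nn_integral_cong) (auto simp: B'_def D'_def indicator_def)
  finally show ?thesis .
qed

section \<open>Integrals of powers over intervals\<close>

lemma nn_integral_powr_from_0:
  assumes "0 < \<alpha>" "0 \<le> t"
  shows "(\<integral>\<^sup>+x\<in>{0<..<t}. ennreal (x powr (\<alpha> - 1)) \<partial>lebesgue) = ennreal (t powr \<alpha> / \<alpha>)"
proof -
  have "(\<integral>\<^sup>+x\<in>{0<..<t}. ennreal (x powr (\<alpha> - 1)) \<partial>lebesgue) = (\<integral>\<^sup>+x\<in>{0..t}. ennreal (x powr (\<alpha> - 1)) \<partial>lborel)"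
    unfolding nn_integral_completion
    using AE_lborel_singleton[of 0] AE_lborel_singleton[of t]
    by (intro nn_integral_cong_AE, eventually_elim) (auto simp: indicator_def)
  also have "\<dots> = ennreal (t powr \<alpha> / \<alpha>)"
    using has_integral_powr_from_0[of "\<alpha> - 1" t] assms
    by (intro nn_integral_has_integral_lebesgue') auto
  finally show ?thesis .
qed

lemma nn_integral_powr_to_inf:
  assumes "\<alpha> < 0" "0 < t"
  shows "(\<integral>\<^sup>+x\<in>{t<..}. ennreal (x powr (\<alpha> - 1)) \<partial>lebesgue) = ennreal (t powr \<alpha> / - \<alpha>)"
proof -
  have "(\<integral>\<^sup>+x\<in>{t<..}. ennreal (x powr (\<alpha> - 1)) \<partial>lebesgue) = (\<integral>\<^sup>+x\<in>{t..}. ennreal (x powr (\<alpha> - 1)) \<partial>lborel)"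
    unfolding nn_integral_completion
    using AE_lborel_singleton[of t]
    by (intro nn_integral_cong_AE, eventually_elim) (auto simp: indicator_def)
  also have "\<dots> = ennreal (t powr \<alpha> / - \<alpha>)"
    using has_integral_powr_to_inf[of "\<alpha> - 1" t] assms
    by (intro nn_integral_has_integral_lebesgue') auto
  finally show ?thesis .
qed

lemma nn_integral_powr_Ioo:
  assumes "\<alpha> \<noteq> 0" "0 < s" "s \<le> t"
  shows "(\<integral>\<^sup>+x\<in>{s<..<t}. ennreal (x powr (\<alpha> - 1)) \<partial>lebesgue) = ennreal ((t powr \<alpha> - s powr \<alpha>) / \<alpha>)"
proof -
  have "(\<integral>\<^sup>+x\<in>{s<..<t}. ennreal (x powr (\<alpha> - 1)) \<partial>lebesgue) = (\<integral>\<^sup>+x\<in>{s..t}. ennreal (x powr (\<alpha> - 1)) \<partial>lborel)"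
    unfolding nn_integral_completion
    using AE_lborel_singleton[of s] AE_lborel_singleton[of t]
    by (intro nn_integral_cong_AE, eventually_elim) (auto simp: indicator_def)
  also have "\<dots> = ennreal (t powr \<alpha> / \<alpha> - s powr \<alpha> / \<alpha>)"
  proof (intro nn_integral_has_integral_lebesgue' fundamental_theorem_of_calculus)
    fix x assume "x \<in> {s..t}"
    then have "((\<lambda>x. x powr \<alpha> / \<alpha>) has_real_derivative x powr (\<alpha> - 1)) (at x within {s..t})"
      using assms by (auto intro!: derivative_eq_intros simp: field_simps powr_diff)
    then show "((\<lambda>x. x powr \<alpha> / \<alpha>) has_vector_derivative x powr (\<alpha> - 1)) (at x within {s..t})"
      by (simp add: has_real_derivative_iff_has_vector_derivative)
  qed (use assms in auto)
  finally show ?thesis by (simp add: diff_divide_distrib)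
qed

section \<open>Slowly varying functions, quasi-norms and averages\<close>

text \<open>Eliminates the auxiliary monotone functions: being equivalent to one means being
  monotone up to the factor \<open>C / c\<close>. The maximum gives one constant for both
  directions.\<close>

lemma SV_comparison:
  assumes "b \<in> SV L" "0 < \<epsilon>"
  obtains C where "0 < C"
    "\<And>s t. t \<in> ival L \<Longrightarrow> 0 < s \<Longrightarrow> s \<le> t \<Longrightarrow> s powr \<epsilon> * b s \<le> C * (t powr \<epsilon> * b t)"
    "\<And>s t. t \<in> ival L \<Longrightarrow> 0 < s \<Longrightarrow> s \<le> t \<Longrightarrow> t powr (- \<epsilon>) * b t \<le> C * (s powr (- \<epsilon>) * b s)"
proof -
  obtain h c C where h: "0 < c" "0 < C" "mono_on (ival L) h"
    "\<forall>t\<in>ival L. c * h t \<le> t powr \<epsilon> * b t \<and> t powr \<epsilon> * b t \<le> C * h t"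
    using assms unfolding SV_def by blast
  obtain h' c' C' where h': "0 < c'" "0 < C'" "antimono_on (ival L) h'"
    "\<forall>t\<in>ival L. c' * h' t \<le> t powr (- \<epsilon>) * b t \<and> t powr (- \<epsilon>) * b t \<le> C' * h' t"
    using assms unfolding SV_def by blast
  have pos: "0 \<le> b t" if "t \<in> ival L" for t
    using assms(1) that unfolding SV_def by (auto intro: less_imp_le)
  show ?thesis
  proof (rule that[of "max (C / c) (C' / c')"])
    show "0 < max (C / c) (C' / c')"
      using h h' by (simp add: less_max_iff_disj)
    fix s t assume st: "t \<in> ival L" "0 < s" "s \<le> t"
    then have s: "s \<in> ival L" by (rule ival_down)
    have "s powr \<epsilon> * b s \<le> C * h s" using h s by blast
    also have "\<dots> \<le> C * h t" using h(2,3) s st by (auto simp: monotone_on_def intro: mult_left_mono)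
    also have "\<dots> = C / c * (c * h t)" using h by simp
    also have "\<dots> \<le> C / c * (t powr \<epsilon> * b t)" using h st by (intro mult_left_mono) auto
    also have "\<dots> \<le> max (C / c) (C' / c') * (t powr \<epsilon> * b t)"
      using pos[OF st(1)] by (intro mult_right_mono) auto
    finally show "s powr \<epsilon> * b s \<le> max (C / c) (C' / c') * (t powr \<epsilon> * b t)" .
    have "t powr (- \<epsilon>) * b t \<le> C' * h' t" using h' st by blast
    also have "\<dots> \<le> C' * h' s" using h'(2,3) s st by (auto simp: monotone_on_def intro: mult_left_mono)
    also have "\<dots> = C' / c' * (c' * h' s)" using h' by simp
    also have "\<dots> \<le> C' / c' * (s powr (- \<epsilon>) * b s)" using h' s by (intro mult_left_mono) auto
    also have "\<dots> \<le> max (C / c) (C' / c') * (s powr (- \<epsilon>) * b s)"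
      using pos[OF s] by (intro mult_right_mono) auto
    finally show "t powr (- \<epsilon>) * b t \<le> max (C / c) (C' / c') * (s powr (- \<epsilon>) * b s)" .
  qed
qed

lemma SV_pos: "b \<in> SV L \<Longrightarrow> t \<in> ival L \<Longrightarrow> 0 < b t"
  by (simp add: SV_def)

lemma SV_measurable: "b \<in> SV L \<Longrightarrow> b \<in> borel_measurable (lebesgue_on (ival L))"
  by (simp add: SV_def)

section \<open>Lebesgue quasi-norms\<close>

lemma Lq_norm_ennreal:
  assumes "0 < q" "A \<in> sets lebesgue"
  shows "Lq_norm (ennreal q) A g = epow (\<integral>\<^sup>+x\<in>A. epow (g x) q \<partial>lebesgue) (1 / q)"
  using assms by (simp add: Lq_norm_def recip_ennreal nn_integral_restrict_space)

lemma Lq_norm_mono_AE: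
  assumes "A \<in> sets lebesgue" "0 < q" "g \<in> borel_measurable (lebesgue_on A)"
    "AE x in lebesgue_on A. g x \<le> g' x"
  shows "Lq_norm q A g \<le> Lq_norm q A g'"
proof (cases "q = \<infinity>")
  case True
  then show ?thesis using assms by (simp add: Lq_norm_def esssup_AE_mono)
next
  case False
  then obtain r where r: "q = ennreal r" "0 < r" using assms(2) by (cases q) auto
  show ?thesis
    using assms(4) r
    by (auto simp: Lq_norm_def recip_ennreal elim!: eventually_mono intro!: epow_mono nn_integral_mono_AE)
qed

lemma Lq_norm_mono:
  assumes "A \<in> sets lebesgue" "0 < q" "g \<in> borel_measurable (lebesgue_on A)"
    "\<And>x. x \<in> A \<Longrightarrow> g x \<le> g' x"
  shows "Lq_norm q A g \<le> Lq_norm q A g'"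
  by (rule Lq_norm_mono_AE) (use assms in auto)

lemma Lq_norm_cmult_le:
  assumes A: "A \<in> sets lebesgue" and "0 < q" and g: "g \<in> borel_measurable (lebesgue_on A)"
  shows "Lq_norm q A (\<lambda>x. c * g x) \<le> c * Lq_norm q A g"
proof (cases "q = \<infinity>")
  case True
  have "AE x in lebesgue_on A. c * g x \<le> c * esssup (lebesgue_on A) g"
    using esssup_AE[of g "lebesgue_on A"] by (auto elim!: eventually_mono intro: mult_left_mono)
  then show ?thesis using True g by (auto simp: Lq_norm_def intro!: esssup_I)
next
  case False
  then obtain r where r: "q = ennreal r" "0 < r" using assms(2) by (cases q) auto
  have "(\<integral>\<^sup>+x. epow (c * g x) r \<partial>lebesgue_on A) = epow c r * (\<integral>\<^sup>+x. epow (g x) r \<partial>lebesgue_on A)"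
    unfolding epow_mult by (rule nn_integral_cmult) (use g in measurable)
  then show ?thesis
    using r by (simp add: Lq_norm_def recip_ennreal epow_mult epow_epow)
qed

lemma Lq_norm_subset:
  assumes "A \<in> sets lebesgue" "B \<in> sets lebesgue" "A \<subseteq> B" "0 < q"
    "g \<in> borel_measurable (lebesgue_on B)"
  shows "Lq_norm q A g \<le> Lq_norm q B g"
proof (cases "q = \<infinity>")
  case True
  have "AE x in lebesgue_on B. g x \<le> esssup (lebesgue_on B) g" by (rule esssup_AE)
  then have "AE x in lebesgue_on A. g x \<le> esssup (lebesgue_on B) g"
    using assms by (auto simp: AE_restrict_space_iff elim!: eventually_mono)
  moreover have "g \<in> borel_measurable (lebesgue_on A)"
    using assms by (rule_tac measurable_restrict_mono[of _ _ B])
  ultimately show ?thesis using True by (auto simp: Lq_norm_def intro!: esssup_I)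
next
  case False
  then obtain r where r: "q = ennreal r" "0 < r" using assms(4) by (cases q) auto
  show ?thesis
    using r assms(1-3) by (auto simp: Lq_norm_ennreal indicator_def intro!: epow_mono nn_integral_mono)
qed

text \<open>Stands in for the triangle inequality, which fails for exponents below 1: a power of a
  maximum is at most the sum of the powers, hence at most twice the larger one after integration.
  For the essential supremum the factor is 1, as \<open>recip\<close> vanishes at infinity.\<close>

lemma Lq_norm_max_le:
  assumes A: "A \<in> sets lebesgue" and "0 < q"
    and [measurable]: "g1 \<in> borel_measurable (lebesgue_on A)" "g2 \<in> borel_measurable (lebesgue_on A)"
  shows "Lq_norm q A (\<lambda>x. max (g1 x) (g2 x))
    \<le> ennreal (2 powr recip q) * max (Lq_norm q A g1) (Lq_norm q A g2)"
proof (cases "q = \<infinity>")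
  case True
  have "AE x in lebesgue_on A. max (g1 x) (g2 x)
      \<le> max (esssup (lebesgue_on A) g1) (esssup (lebesgue_on A) g2)"
    using esssup_AE[of g1 "lebesgue_on A"] esssup_AE[of g2 "lebesgue_on A"] by eventually_elim (auto simp: le_max_iff_disj)
  then show ?thesis using True by (auto simp: Lq_norm_def recip_top[simplified] intro!: esssup_I)
next
  case False
  then obtain r where r: "q = ennreal r" "0 < r" using assms(2) by (cases q) auto
  let ?I = "\<lambda>g. \<integral>\<^sup>+x. epow (g x) r \<partial>lebesgue_on A"
  have "?I (\<lambda>x. max (g1 x) (g2 x)) \<le> (\<integral>\<^sup>+x. epow (g1 x) r + epow (g2 x) r \<partial>lebesgue_on A)"
    by (intro nn_integral_mono) (auto simp: max_def add_increasing add_increasing2)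
  also have "\<dots> = ?I g1 + ?I g2"
    by (rule nn_integral_add) measurable
  also have "\<dots> \<le> ennreal 2 * max (?I g1) (?I g2)"
    by (auto simp: mult_2 intro!: add_mono)
  finally have "epow (?I (\<lambda>x. max (g1 x) (g2 x))) (1 / r) \<le> epow (ennreal 2 * max (?I g1) (?I g2)) (1 / r)"
    using r by (intro epow_mono) auto
  also have "\<dots> = ennreal (2 powr (1 / r)) * epow (max (?I g1) (?I g2)) (1 / r)"
    by (simp add: epow_mult epow_ennreal del: ennreal_numeral)
  also have "epow (max (?I g1) (?I g2)) (1 / r) \<le> max (epow (?I g1) (1 / r)) (epow (?I g2) (1 / r))"
    by (simp add: max_def epow_mono r)
  finally show ?thesis using r by (simp add: Lq_norm_def recip_ennreal mult_left_mono)
qed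

lemma Lq_norm_eq_0_imp_AE:
  assumes "0 < q" "g \<in> borel_measurable (lebesgue_on A)" "Lq_norm q A g = 0"
  shows "AE x in lebesgue_on A. g x = 0"
proof (cases "q = \<infinity>")
  case True
  then show ?thesis
    using esssup_AE[of g "lebesgue_on A"] assms(3) by (simp add: Lq_norm_def)
next
  case False
  then obtain r where r: "q = ennreal r" "0 < r" using assms(1) by (cases q) auto
  have "(\<integral>\<^sup>+x. epow (g x) r \<partial>lebesgue_on A) = 0"
    using assms r by (simp add: Lq_norm_def)
  then show ?thesis using assms(2) by (subst (asm) nn_integral_0_iff_AE) auto
qed

text \<open>The common form of \<open>H_upper\<close> and \<open>H_lower\<close> at \<open>t\<close>, with \<open>A\<close> the interval of integration,
  \<open>u\<close> the reciprocal of the outer exponent, and \<open>F\<close> in place of the rearrangement.\<close>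

definition avg :: "real \<Rightarrow> real \<Rightarrow> real set \<Rightarrow> (real \<Rightarrow> ennreal) \<Rightarrow> real \<Rightarrow> ennreal" where
  "avg u \<omega> A F t = ennreal (t powr (- u)) *
     epow (\<integral>\<^sup>+v\<in>A. ennreal (v powr (u * \<omega> - 1)) * epow (F v) \<omega> \<partial>lebesgue) (1 / \<omega>)"

lemma Lq_norm_eq_avg:
  assumes "0 < \<omega>" "A \<in> sets lebesgue" "A \<subseteq> {0<..}"
  shows "ennreal (t powr (- u)) * Lq_norm (ennreal \<omega>) A (\<lambda>v. ennreal (v powr (u - 1 / \<omega>)) * F v) = avg u \<omega> A F t"
proof -
  have "(\<integral>\<^sup>+v\<in>A. epow (ennreal (v powr (u - 1 / \<omega>)) * F v) \<omega> \<partial>lebesgue)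
      = (\<integral>\<^sup>+v\<in>A. ennreal (v powr (u * \<omega> - 1)) * epow (F v) \<omega> \<partial>lebesgue)"
    using assms by (intro nn_integral_cong)
      (auto simp: epow_mult epow_ennreal powr_powr algebra_simps indicator_def)
  then show ?thesis using assms by (simp add: avg_def Lq_norm_ennreal)
qed

lemma H_upper_eq_avg:
  "0 < \<omega> \<Longrightarrow> H_upper L U (ennreal \<omega>) f t = avg (recip U) \<omega> {0<..<t} (rearr L f) t"
  by (subst Lq_norm_eq_avg[symmetric]) (auto simp: H_upper_def recip_ennreal)

lemma H_lower_eq_avg:
  "0 < \<omega> \<Longrightarrow> H_lower L V (ennreal \<omega>) f t = avg (recip V) \<omega> (ival L \<inter> {t<..}) (rearr L f) t"
  by (subst Lq_norm_eq_avg[symmetric]) (auto simp: H_lower_def recip_ennreal ival_pos)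

lemma avg_mono:
  assumes "0 < \<omega>" "A \<in> sets lebesgue" "A \<subseteq> B" "AE v in lebesgue. v \<in> A \<longrightarrow> F v \<le> F' v"
  shows "avg u \<omega> A F t \<le> avg u \<omega> B F' t"
  unfolding avg_def using assms
  by (intro mult_left_mono epow_mono nn_integral_mono_AE)
    (auto elim!: eventually_mono simp: indicator_def intro!: mult_left_mono epow_mono)

text \<open>The factor \<open>X\<close> is an arbitrary element of \<open>ennreal\<close>, because
  it will be a norm of \<open>F\<close> that may be infinite.\<close>

lemma avg_powr:
  assumes "0 < \<omega>" "A \<in> sets lebesgue" "A \<subseteq> {0<..}"
  shows "avg u \<omega> A (\<lambda>v. ennreal (v powr (- \<kappa>)) * X) t =
    ennreal (t powr (- u)) * epow (\<integral>\<^sup>+v\<in>A. ennreal (v powr ((u - \<kappa>) * \<omega> - 1)) \<partial>lebesgue) (1 / \<omega>) * X"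
proof -
  have m: "(\<lambda>v. ennreal (v powr ((u - \<kappa>) * \<omega> - 1))) \<in> borel_measurable lebesgue"
    by (rule borel_imp_lebesgue_measurable) measurable
  have "(\<integral>\<^sup>+v\<in>A. ennreal (v powr (u * \<omega> - 1)) * epow (ennreal (v powr (- \<kappa>)) * X) \<omega> \<partial>lebesgue)
      = (\<integral>\<^sup>+v. (ennreal (v powr ((u - \<kappa>) * \<omega> - 1)) * indicator A v) * epow X \<omega> \<partial>lebesgue)"
  proof (intro nn_integral_cong)
    fix v :: real
    have e: "(u * \<omega> - 1) + - \<kappa> * \<omega> = (u - \<kappa>) * \<omega> - 1"
      by (simp add: algebra_simps)
    have "v powr (u * \<omega> - 1) * (v powr (- \<kappa>)) powr \<omega> = v powr ((u - \<kappa>) * \<omega> - 1)"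
      unfolding powr_powr powr_add[symmetric] e ..
    then have "ennreal (v powr (u * \<omega> - 1)) * epow (ennreal (v powr (- \<kappa>))) \<omega>
        = ennreal (v powr ((u - \<kappa>) * \<omega> - 1))"
      by (simp add: epow_ennreal flip: ennreal_mult)
    then show "ennreal (v powr (u * \<omega> - 1)) * epow (ennreal (v powr (- \<kappa>)) * X) \<omega> * indicator A v
        = ennreal (v powr ((u - \<kappa>) * \<omega> - 1)) * indicator A v * epow X \<omega>"
      by (simp add: epow_mult indicator_def mult.assoc[symmetric])
  qed
  also have "\<dots> = (\<integral>\<^sup>+v\<in>A. ennreal (v powr ((u - \<kappa>) * \<omega> - 1)) \<partial>lebesgue) * epow X \<omega>"
    by (intro nn_integral_multc borel_measurable_times_ennreal m borel_measurable_indicator assms(2))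
  finally show ?thesis
    using assms(1) by (simp add: avg_def epow_mult epow_inverse mult.assoc)
qed

text \<open>A power is an eigenfunction of the averaging over (0, t), and the eigenvalue blows up as
  \<kappa> tends to \<open>u\<close>. With \<kappa> fixed this is an upper bound; with \<kappa>
  close to \<open>u\<close> it is the source of the counterexample.\<close>

lemma avg_upper_powr:
  assumes "0 < \<omega>" "\<kappa> < u" "0 < t"
  shows "avg u \<omega> {0<..<t} (\<lambda>v. ennreal (v powr (- \<kappa>)) * X) t =
    ennreal ((1 / ((u - \<kappa>) * \<omega>)) powr (1 / \<omega>) * t powr (- \<kappa>)) * X"
proof -
  have "avg u \<omega> {0<..<t} (\<lambda>v. ennreal (v powr (- \<kappa>)) * X) t
      = ennreal (t powr (- u)) * epow (ennreal (t powr ((u - \<kappa>) * \<omega>) / ((u - \<kappa>) * \<omega>))) (1 / \<omega>) * X"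
    using assms nn_integral_powr_from_0[of "(u - \<kappa>) * \<omega>" t] by (subst avg_powr) auto
  also have "ennreal (t powr (- u)) * epow (ennreal (t powr ((u - \<kappa>) * \<omega>) / ((u - \<kappa>) * \<omega>))) (1 / \<omega>)
      = ennreal (t powr (- u) * ((t powr ((u - \<kappa>) * \<omega>) / ((u - \<kappa>) * \<omega>)) powr (1 / \<omega>)))"
    using assms by (simp add: epow_ennreal ennreal_mult)
  also have "t powr (- u) * ((t powr ((u - \<kappa>) * \<omega>) / ((u - \<kappa>) * \<omega>)) powr (1 / \<omega>))
      = (1 / ((u - \<kappa>) * \<omega>)) powr (1 / \<omega>) * (t powr (- u) * t powr (u - \<kappa>))"
    using assms by (simp add: powr_divide powr_powr)
  also have "t powr (- u) * t powr (u - \<kappa>) = t powr (- \<kappa>)"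
    by (simp flip: powr_add)
  finally show ?thesis .
qed

text \<open>Only an inequality, since the range of integration is enlarged to the half-line beyond
  \<open>t\<close> in order to treat finite and infinite \<open>L\<close> alike.\<close>

lemma avg_lower_powr_le:
  assumes "0 < \<omega>" "u < \<kappa>" "0 < t"
  shows "avg u \<omega> (ival L \<inter> {t<..}) (\<lambda>v. ennreal (v powr (- \<kappa>)) * X) t \<le>
    ennreal ((1 / ((\<kappa> - u) * \<omega>)) powr (1 / \<omega>) * t powr (- \<kappa>)) * X"
proof -
  have neg: "(u - \<kappa>) * \<omega> < 0"
    using assms by (simp add: mult_less_0_iff)
  have "avg u \<omega> (ival L \<inter> {t<..}) (\<lambda>v. ennreal (v powr (- \<kappa>)) * X) t
      \<le> avg u \<omega> {t<..} (\<lambda>v. ennreal (v powr (- \<kappa>)) * X) t"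
    by (rule avg_mono) (use assms in auto)
  also have "\<dots> = ennreal (t powr (- u)) * epow (ennreal (t powr ((u - \<kappa>) * \<omega>) / - ((u - \<kappa>) * \<omega>))) (1 / \<omega>) * X"
    using assms by (subst avg_powr) (simp_all only: nn_integral_powr_to_inf[OF neg \<open>0 < t\<close>], auto)
  also have "- ((u - \<kappa>) * \<omega>) = (\<kappa> - u) * \<omega>"
    by (simp add: algebra_simps)
  also have "ennreal (t powr (- u)) * epow (ennreal (t powr ((u - \<kappa>) * \<omega>) / ((\<kappa> - u) * \<omega>))) (1 / \<omega>)
      = ennreal (t powr (- u) * ((t powr ((u - \<kappa>) * \<omega>) / ((\<kappa> - u) * \<omega>)) powr (1 / \<omega>)))"
    using assms by (simp add: epow_ennreal ennreal_mult)
  also have "t powr (- u) * ((t powr ((u - \<kappa>) * \<omega>) / ((\<kappa> - u) * \<omega>)) powr (1 / \<omega>))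
      = (1 / ((\<kappa> - u) * \<omega>)) powr (1 / \<omega>) * (t powr (- u) * t powr (u - \<kappa>))"
    using assms by (simp add: powr_divide powr_powr)
  also have "t powr (- u) * t powr (u - \<kappa>) = t powr (- \<kappa>)"
    by (simp flip: powr_add)
  finally show ?thesis .
qed

section \<open>Hardy inequalities\<close>

text \<open>The factor \<open>e / (1 - 2 powr (- e))\<close> is the reciprocal of the integral of \<open>x powr (e - 1)\<close> over
  \<open>(1/2, 1)\<close>.\<close>

lemma antimono_epow_le_integral:
  assumes F: "antimono F" and "0 < v" "0 < e" "0 < \<rho>"
  shows "epow (F v) \<rho> \<le> ennreal (v powr (- e) * (e / (1 - 2 powr (- e)))) *
    (\<integral>\<^sup>+x\<in>{v/2<..<v}. ennreal (x powr (e - 1)) * epow (F x) \<rho> \<partial>lebesgue)"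
proof -
  let ?c = "(1 - 2 powr (- e)) / e"
  have c: "0 < ?c"
    using assms powr_less_mono[of "- e" 0 2] by simp
  define d where "d = e / (1 - 2 powr (- e))"
  have d: "d * ?c = 1" "0 \<le> d"
    using assms powr_less_mono[of "- e" 0 2] by (auto simp: d_def)
  have m: "(\<lambda>x. ennreal (x powr (e - 1))) \<in> borel_measurable lebesgue"
    by (rule borel_imp_lebesgue_measurable) measurable
  have "(v powr e - (v / 2) powr e) / e = v powr e * ?c"
    using assms by (simp add: powr_divide powr_minus_divide field_simps)
  then have "ennreal (v powr e * ?c) * epow (F v) \<rho>
      = (\<integral>\<^sup>+x\<in>{v/2<..<v}. ennreal (x powr (e - 1)) \<partial>lebesgue) * epow (F v) \<rho>"
    using assms nn_integral_powr_Ioo[of e "v/2" v] by simp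
  also have "\<dots> = (\<integral>\<^sup>+x. ennreal (x powr (e - 1)) * indicator {v/2<..<v} x * epow (F v) \<rho> \<partial>lebesgue)"
    by (intro nn_integral_multc[symmetric] borel_measurable_times_ennreal m borel_measurable_indicator) auto
  also have "\<dots> \<le> (\<integral>\<^sup>+x\<in>{v/2<..<v}. ennreal (x powr (e - 1)) * epow (F x) \<rho> \<partial>lebesgue)" (is "_ \<le> ?I")
    using F assms
    by (intro nn_integral_mono) (auto simp: indicator_def antimono_def intro!: mult_left_mono epow_mono)
  finally have "ennreal (v powr (- e) * d) * (ennreal (v powr e * ?c) * epow (F v) \<rho>)
      \<le> ennreal (v powr (- e) * d) * ?I"
    by (rule mult_left_mono) simp
  moreover have "ennreal (v powr (- e) * d) * ennreal (v powr e * ?c) = 1"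
  proof -
    have "v powr (- e) * d * (v powr e * ?c) = (v powr (- e) * v powr e) * (d * ?c)"
      by (simp only: ac_simps)
    also have "\<dots> = 1"
      using d assms by (simp only: powr_add[symmetric]) simp
    finally have "ennreal (v powr (- e) * d * (v powr e * ?c)) = 1"
      by (simp only: ennreal_1)
    then show ?thesis
      using mult_nonneg_nonneg[OF powr_ge_zero less_imp_le[OF c]] d
      by (subst ennreal_mult[symmetric]) simp_all
  qed
  ultimately show ?thesis
    by (simp only: mult.assoc[symmetric] mult_1_left d_def)
qed

text \<open>By \<open>antimono_epow_le_integral\<close>, every value of \<open>F\<close> on
  \<open>A\<close> is at most \<open>v powr (- \<kappa>)\<close> times one quantity
  \<open>X\<close>, a weighted norm of \<open>F\<close> over \<open>E\<close> that does not depend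
  on \<open>v\<close>. Averaging this power is the assumption \<open>bound\<close>. The set
  \<open>E\<close> has to contain all intervals from v/2 to v and may be larger than
  \<open>A\<close>. Since the passage is pointwise, \<rho> and \<omega> can be in either
  order.\<close>

lemma epow_avg_le:
  assumes F: "antimono F" and pos: "0 < \<omega>" "0 < \<rho>" "0 < \<kappa>" "0 \<le> C" "0 < t"
    and A: "A \<in> sets lebesgue" "A \<subseteq> {0<..}" and E: "\<And>v. v \<in> A \<Longrightarrow> {v/2<..<v} \<subseteq> E"
    and bound: "\<And>X. avg u \<omega> A (\<lambda>v. ennreal (v powr (- \<kappa>)) * X) t \<le> ennreal (C * t powr (- \<kappa>)) * X"
  shows "epow (avg u \<omega> A F t) \<rho> \<le>
    ennreal (C powr \<rho> * (\<kappa> * \<rho> / (1 - 2 powr (- (\<kappa> * \<rho>)))) * t powr (- (\<kappa> * \<rho>))) *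
    (\<integral>\<^sup>+x\<in>E. ennreal (x powr (\<kappa> * \<rho> - 1)) * epow (F x) \<rho> \<partial>lebesgue)"
proof -
  define e where "e = \<kappa> * \<rho>"
  have e: "0 < e" using pos by (simp add: e_def)
  define Y where "Y = (\<integral>\<^sup>+x\<in>E. ennreal (x powr (e - 1)) * epow (F x) \<rho> \<partial>lebesgue)"
  define d where "d = e / (1 - 2 powr (- e))"
  have d: "0 \<le> d"
    using e powr_less_mono[of "- e" 0 2] by (simp add: d_def)
  define X where "X = epow (ennreal d * Y) (1 / \<rho>)"
  have "F v \<le> ennreal (v powr (- \<kappa>)) * X" if v: "v \<in> A" for v
  proof -
    have v0: "0 < v" using v A by auto
    have "epow (F v) \<rho> \<le> ennreal (v powr (- e) * d) *
      (\<integral>\<^sup>+x\<in>{v/2<..<v}. ennreal (x powr (e - 1)) * epow (F x) \<rho> \<partial>lebesgue)"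
      unfolding d_def by (rule antimono_epow_le_integral) (use F v0 e pos in auto)
    also have "\<dots> \<le> ennreal (v powr (- e) * d) * Y"
      unfolding Y_def using E[OF v] by (intro mult_left_mono nn_integral_mono) (auto simp: indicator_def)
    finally have "F v \<le> epow (ennreal (v powr (- e) * d) * Y) (1 / \<rho>)"
      using pos by (intro epow_le_imp)
    also have "ennreal (v powr (- e) * d) * Y = ennreal (v powr (- e)) * (ennreal d * Y)"
      using d by (simp add: ennreal_mult mult.assoc)
    also have "epow \<dots> (1 / \<rho>) = ennreal (v powr (- \<kappa>)) * X"
      using pos by (simp add: X_def epow_mult epow_ennreal powr_powr e_def)
    finally show ?thesis .
  qed
  then have "avg u \<omega> A F t \<le> avg u \<omega> A (\<lambda>v. ennreal (v powr (- \<kappa>)) * X) t"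
    using pos A by (intro avg_mono) auto
  also have "\<dots> \<le> ennreal (C * t powr (- \<kappa>)) * X"
    by (rule bound)
  finally have "epow (avg u \<omega> A F t) \<rho> \<le> epow (ennreal (C * t powr (- \<kappa>)) * X) \<rho>"
    using pos by (intro epow_mono)
  also have "\<dots> = ennreal ((C * t powr (- \<kappa>)) powr \<rho>) * (ennreal d * Y)"
    using pos by (simp add: epow_mult epow_ennreal X_def epow_inverse)
  also have "(C * t powr (- \<kappa>)) powr \<rho> = C powr \<rho> * t powr (- e)"
    using pos by (simp add: powr_mult powr_powr e_def)
  also have "ennreal (C powr \<rho> * t powr (- e)) * (ennreal d * Y) = ennreal (C powr \<rho> * d * t powr (- e)) * Y"
    using d by (simp add: ennreal_mult ac_simps)
  finally show ?thesis
    by (simp add: Y_def d_def e_def)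
qed

lemma B_norm_ennreal:
  assumes "0 < \<rho>" "b \<in> SV L"
  shows "B_norm L p (ennreal \<rho>) b g =
    epow (\<integral>\<^sup>+t\<in>ival L. ennreal (t powr (recip p * \<rho> - 1) * b t powr \<rho>) * epow (g t) \<rho> \<partial>lebesgue) (1 / \<rho>)"
proof -
  have "(\<integral>\<^sup>+t\<in>ival L. epow (ennreal (t powr (recip p - 1 / \<rho>) * b t) * g t) \<rho> \<partial>lebesgue)
    = (\<integral>\<^sup>+t\<in>ival L. ennreal (t powr (recip p * \<rho> - 1) * b t powr \<rho>) * epow (g t) \<rho> \<partial>lebesgue)"
  proof (intro nn_integral_cong)
    fix t :: real
    have e: "(recip p - 1 / \<rho>) * \<rho> = recip p * \<rho> - 1"
      using assms by (simp add: field_simps)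
    show "epow (ennreal (t powr (recip p - 1 / \<rho>) * b t) * g t) \<rho> * indicator (ival L) t
        = ennreal (t powr (recip p * \<rho> - 1) * b t powr \<rho>) * epow (g t) \<rho> * indicator (ival L) t"
      using SV_pos[OF assms(2), of t] e
      by (cases "t \<in> ival L") (auto simp: epow_mult epow_ennreal powr_mult powr_powr less_imp_le)
  qed
  then show ?thesis
    using assms by (simp add: B_norm_def Lq_norm_ennreal recip_ennreal)
qed

lemma ennreal_indicator_measurable:
  assumes "(\<lambda>x. ennreal (g x)) \<in> borel_measurable (lebesgue_on S)" "S \<in> sets lebesgue"
  shows "(\<lambda>x. ennreal (g x) * indicator S x) \<in> borel_measurable lebesgue"
  using assms by (simp add: borel_measurable_restrict_space_iff_ennreal)

lemma lebesgue_on_borel: "f \<in> borel_measurable borel \<Longrightarrow> f \<in> borel_measurable (lebesgue_on S)"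
  by (intro measurable_restrict_space1 borel_imp_lebesgue_measurable)

lemma weight_measurable:
  assumes "b \<in> SV L"
  shows "(\<lambda>t. ennreal (t powr \<alpha> * b t powr \<beta>)) \<in> borel_measurable (lebesgue_on (ival L))"
    "(\<lambda>t. ennreal (t powr \<alpha> * b t)) \<in> borel_measurable (lebesgue_on (ival L))"
proof -
  note [measurable] = SV_measurable[OF assms]
  have [measurable]: "(\<lambda>t. t powr \<alpha>) \<in> borel_measurable (lebesgue_on (ival L))"
    by (rule lebesgue_on_borel) measurable
  show "(\<lambda>t. ennreal (t powr \<alpha> * b t powr \<beta>)) \<in> borel_measurable (lebesgue_on (ival L))"
    "(\<lambda>t. ennreal (t powr \<alpha> * b t)) \<in> borel_measurable (lebesgue_on (ival L))"
    by measurable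
qed

text \<open>Common core of both Hardy inequalities for finite \<open>r\<close>. By
  \<open>epow_avg_le\<close> the \<rho>-th power of the average is a linear transform of the
  \<rho>-th power of \<open>F\<close>, with kernel \<open>t powr (- (\<kappa> * \<rho>)) * x powr
  (\<kappa> * \<rho> - 1)\<close> on \<open>x \<in> E t\<close> up to a constant. The assumption
  \<open>weight\<close> is what \<open>kernel_integral_le\<close> asks of this kernel, after the
  power of \<open>x\<close> has been taken out.\<close>

lemma hardy_finite:
  fixes A E :: "real \<Rightarrow> real set"
  assumes F: "antimono F" and pos: "0 < \<omega>" "0 < \<rho>" "0 < \<kappa>" "0 \<le> C" "0 \<le> K" and b: "b \<in> SV L"
    and A: "\<And>t. t \<in> ival L \<Longrightarrow> A t \<in> sets lebesgue" "\<And>t. t \<in> ival L \<Longrightarrow> A t \<subseteq> ival L"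
    and E: "\<And>t v. t \<in> ival L \<Longrightarrow> v \<in> A t \<Longrightarrow> {v/2<..<v} \<subseteq> E t"
      "{(t, x). x \<in> E t} \<in> sets (borel \<Otimes>\<^sub>M borel)"
    and bound: "\<And>t X. t \<in> ival L \<Longrightarrow>
      avg u \<omega> (A t) (\<lambda>v. ennreal (v powr (- \<kappa>)) * X) t \<le> ennreal (C * t powr (- \<kappa>)) * X"
    and weight: "\<And>x. x \<in> ival L \<Longrightarrow>
      (\<integral>\<^sup>+t\<in>ival L. ennreal (t powr ((recip p - \<kappa>) * \<rho> - 1) * b t powr \<rho>) * indicator (E t) x \<partial>lebesgue)
        \<le> ennreal (K * (x powr ((recip p - \<kappa>) * \<rho>) * b x powr \<rho>))"
  shows "B_norm L p (ennreal \<rho>) b (\<lambda>t. avg u \<omega> (A t) F t) \<le>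
    ennreal ((C powr \<rho> * (\<kappa> * \<rho> / (1 - 2 powr (- (\<kappa> * \<rho>)))) * K) powr (1 / \<rho>)) * B_norm L p (ennreal \<rho>) b F"
proof -
  define P where "P = recip p"
  define e where "e = \<kappa> * \<rho>"
  have e: "0 < e" using pos by (simp add: e_def)
  define C' where "C' = C powr \<rho> * (e / (1 - 2 powr (- e)))"
  have C': "0 \<le> C'"
    using e powr_less_mono[of "- e" 0 2] by (simp add: C'_def)
  define w where "w t = ennreal (t powr (P * \<rho> - 1) * b t powr \<rho>)" for t
  define k where "k t x = ennreal (C' * t powr (- e) * x powr (e - 1)) * indicator (E t) x" for t x
  note [measurable] = E(2)
  have Fm: "F \<in> borel_measurable borel"
    by (rule borel_measurable_antimono_ennreal[OF F])
  have wm: "(\<lambda>t. w t * indicator (ival L) t) \<in> borel_measurable lebesgue"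
    unfolding w_def by (intro ennreal_indicator_measurable weight_measurable b) simp
  have "(\<integral>\<^sup>+t\<in>ival L. w t * epow (avg u \<omega> (A t) F t) \<rho> \<partial>lebesgue)
      \<le> ennreal (C' * K) * (\<integral>\<^sup>+t\<in>ival L. w t * epow (F t) \<rho> \<partial>lebesgue)"
  proof (rule kernel_integral_le[where k = k, OF ival_lebesgue wm _ wm])
    show "(\<lambda>t. epow (F t) \<rho> * indicator (ival L) t) \<in> borel_measurable lebesgue"
      by (intro borel_imp_lebesgue_measurable borel_measurable_times_ennreal borel_measurable_epow Fm
          borel_measurable_indicator ival_borel)
    have "(\<lambda>(t, x). k t x) = (\<lambda>z. ennreal (C' * fst z powr (- e) * snd z powr (e - 1)) * indicator {(t, x). x \<in> E t} z)"
      by (auto simp: k_def indicator_def)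
    then show "(\<lambda>(t, x). k t x) \<in> borel_measurable (borel \<Otimes>\<^sub>M borel)"
      by simp
  next
    fix t assume t: "t \<in> ival L"
    \<comment> \<open>The interval (0, L) reaches down to 0, so it contains each (v/2, v) with
      \<open>v \<in> A t\<close>; hence \<open>E t\<close> may be intersected with it.\<close>
    have "epow (avg u \<omega> (A t) F t) \<rho> \<le> ennreal (C' * t powr (- e)) *
      (\<integral>\<^sup>+x\<in>E t \<inter> ival L. ennreal (x powr (e - 1)) * epow (F x) \<rho> \<partial>lebesgue)"
      unfolding C'_def e_def
    proof (rule epow_avg_le[OF F pos(1,2,3,4)])
      fix v assume v: "v \<in> A t"
      then have "v \<in> ival L" using A(2) t by auto
      then show "{v / 2<..<v} \<subseteq> E t \<inter> ival L"
        using E(1)[OF t v] ival_pos[of v L] by (auto intro: ival_down)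
    qed (use t A[OF t] bound in \<open>auto simp: ival_pos\<close>)
    also have "\<dots> = (\<integral>\<^sup>+x\<in>ival L. k t x * epow (F x) \<rho> \<partial>lebesgue)"
    proof (subst nn_integral_cmult[symmetric])
      have E': "E t \<in> sets borel"
        using sets_Pair1[OF E(2), of t] by (simp add: vimage_def)
      have "(\<lambda>x. ennreal (x powr (e - 1)) * epow (F x) \<rho> * indicator (E t \<inter> ival L) x) \<in> borel_measurable borel"
        using Fm E' by measurable
      then show "(\<lambda>x. ennreal (x powr (e - 1)) * epow (F x) \<rho> * indicator (E t \<inter> ival L) x) \<in> borel_measurable lebesgue"
        by (rule borel_imp_lebesgue_measurable)
    qed (use C' in \<open>auto intro!: nn_integral_cong simp: k_def indicator_def ennreal_mult mult.assoc\<close>)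
    finally show "epow (avg u \<omega> (A t) F t) \<rho> \<le> (\<integral>\<^sup>+x\<in>ival L. k t x * epow (F x) \<rho> \<partial>lebesgue)" .
  next
    fix x assume x: "x \<in> ival L"
    have eq: "(P - \<kappa>) * \<rho> - 1 = (P * \<rho> - 1) + - e" "(P - \<kappa>) * \<rho> + (e - 1) = P * \<rho> - 1"
      by (simp_all add: e_def algebra_simps)
    have "(\<lambda>t. indicator (E t) x :: ennreal) = (\<lambda>t. indicator {(t, x). x \<in> E t} (t, x))"
      by (auto simp: indicator_def)
    then have Em: "(\<lambda>t. indicator (E t) x :: ennreal) \<in> borel_measurable borel"
      by simp
    have "(\<integral>\<^sup>+t\<in>ival L. w t * k t x \<partial>lebesgue) = (\<integral>\<^sup>+t. ennreal (C' * x powr (e - 1)) *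
        (ennreal (t powr ((P - \<kappa>) * \<rho> - 1) * b t powr \<rho>) * indicator (ival L) t * indicator (E t) x) \<partial>lebesgue)"
      using C' unfolding eq powr_add
      by (intro nn_integral_cong) (auto simp: w_def k_def indicator_def ac_simps simp flip: ennreal_mult)
    also have "\<dots> = ennreal (C' * x powr (e - 1)) * (\<integral>\<^sup>+t.
        ennreal (t powr ((P - \<kappa>) * \<rho> - 1) * b t powr \<rho>) * indicator (ival L) t * indicator (E t) x \<partial>lebesgue)"
      by (intro nn_integral_cmult borel_measurable_times_ennreal ennreal_indicator_measurable weight_measurable b
          borel_imp_lebesgue_measurable[OF Em]) simp
    also have "\<dots> \<le> ennreal (C' * x powr (e - 1)) * ennreal (K * (x powr ((P - \<kappa>) * \<rho>) * b x powr \<rho>))"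
      using weight[OF x] by (intro mult_left_mono) (auto simp: P_def ac_simps)
    also have "\<dots> = ennreal (C' * x powr (e - 1) * (K * (x powr ((P - \<kappa>) * \<rho>) * b x powr \<rho>)))"
      using C' pos by (intro ennreal_mult[symmetric]) auto
    also have "C' * x powr (e - 1) * (K * (x powr ((P - \<kappa>) * \<rho>) * b x powr \<rho>))
        = (C' * K) * (x powr ((P - \<kappa>) * \<rho>) * x powr (e - 1) * b x powr \<rho>)"
      by (simp add: ac_simps)
    also have "x powr ((P - \<kappa>) * \<rho>) * x powr (e - 1) = x powr (P * \<rho> - 1)"
      unfolding powr_add[symmetric] eq ..
    also have "ennreal (C' * K * (x powr (P * \<rho> - 1) * b x powr \<rho>)) = ennreal (C' * K) * w x"
      using C' pos unfolding w_def by (intro ennreal_mult) auto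
    finally show "(\<integral>\<^sup>+t\<in>ival L. w t * k t x \<partial>lebesgue) \<le> ennreal (C' * K) * w x" .
  qed
  then have "epow (\<integral>\<^sup>+t\<in>ival L. w t * epow (avg u \<omega> (A t) F t) \<rho> \<partial>lebesgue) (1 / \<rho>)
      \<le> epow (ennreal (C' * K) * (\<integral>\<^sup>+t\<in>ival L. w t * epow (F t) \<rho> \<partial>lebesgue)) (1 / \<rho>)"
    using pos by (intro epow_mono) auto
  also have "\<dots> = ennreal ((C' * K) powr (1 / \<rho>)) * epow (\<integral>\<^sup>+t\<in>ival L. w t * epow (F t) \<rho> \<partial>lebesgue) (1 / \<rho>)"
    using C' pos by (simp add: epow_mult epow_ennreal)
  finally show ?thesis
    using pos b by (simp add: B_norm_ennreal w_def P_def C'_def e_def)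
qed

lemma ennreal_mult_assoc3:
  "0 \<le> x \<Longrightarrow> 0 \<le> y \<Longrightarrow> 0 \<le> z \<Longrightarrow> ennreal x * (ennreal y * (ennreal z * M)) = ennreal (x * y * z) * M"
  by (simp add: ennreal_mult mult.assoc)

text \<open>For \<open>r = \<infinity>\<close> the norm itself is a pointwise bound on
  \<open>F\<close> almost everywhere. The assumption \<open>weight\<close> converts that bound on
  \<open>A t\<close> into a multiple of \<open>v powr (- \<kappa>)\<close>, and \<open>bound\<close>
  averages it.\<close>

lemma hardy_infinite:
  fixes A :: "real \<Rightarrow> real set"
  assumes pos: "0 < \<omega>" "0 \<le> C" "0 \<le> K" and b: "b \<in> SV L"
    and A: "\<And>t. t \<in> ival L \<Longrightarrow> A t \<in> sets lebesgue" "\<And>t. t \<in> ival L \<Longrightarrow> A t \<subseteq> ival L"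
    and meas: "(\<lambda>t. avg u \<omega> (A t) F t) \<in> borel_measurable (lebesgue_on (ival L))"
    and bound: "\<And>t X. t \<in> ival L \<Longrightarrow>
      avg u \<omega> (A t) (\<lambda>v. ennreal (v powr (- \<kappa>)) * X) t \<le> ennreal (C * t powr (- \<kappa>)) * X"
    and weight: "\<And>t v. t \<in> ival L \<Longrightarrow> v \<in> A t \<Longrightarrow>
      t powr (recip p - \<kappa>) * b t \<le> K * (v powr (recip p - \<kappa>) * b v)"
  shows "B_norm L p \<infinity> b (\<lambda>t. avg u \<omega> (A t) F t) \<le> ennreal (C * K) * B_norm L p \<infinity> b F"
proof -
  define P where "P = recip p"
  define M where "M = B_norm L p \<infinity> b F"
  have "AE v in lebesgue_on (ival L). ennreal (v powr P * b v) * F v \<le> M"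
    using esssup_AE[of "\<lambda>v. ennreal (v powr P * b v) * F v" "lebesgue_on (ival L)"]
    by (simp add: M_def B_norm_def Lq_norm_def recip_top[simplified] P_def)
  then have AE: "AE v in lebesgue. v \<in> ival L \<longrightarrow> ennreal (v powr P * b v) * F v \<le> M"
    by (simp add: AE_restrict_space_iff)
  have "ennreal (t powr P * b t) * avg u \<omega> (A t) F t \<le> ennreal (C * K) * M" if t: "t \<in> ival L" for t
  proof -
    have bt: "0 < b t" "0 < t" using SV_pos[OF b t] ival_pos[OF t] .
    \<comment> \<open>The bound \<open>M / (v powr P * b v)\<close> equals
      \<open>v powr (- \<kappa>)\<close> times \<open>M / (v powr (P - \<kappa>) * b v)\<close>. By
      \<open>weight\<close>, the value at \<open>v\<close> in the last denominator may be replaced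
      by the value at \<open>t\<close> at the price of \<open>K\<close>.\<close>
    define X where "X = ennreal (K * t powr (\<kappa> - P) / b t) * M"
    have "AE v in lebesgue. v \<in> A t \<longrightarrow> F v \<le> ennreal (v powr (- \<kappa>)) * X"
      using AE
    proof eventually_elim
      case (elim v)
      show ?case
      proof
        assume v: "v \<in> A t"
        then have vI: "v \<in> ival L" using A(2) t by auto
        have bv: "0 < b v" "0 < v" using SV_pos[OF b vI] ival_pos[OF vI] .
        have "F v = ennreal (1 / (v powr P * b v)) * (ennreal (v powr P * b v) * F v)"
          using bv by (simp add: mult.assoc[symmetric] flip: ennreal_mult)
        also have "\<dots> \<le> ennreal (1 / (v powr P * b v)) * M"
          using elim vI by (intro mult_left_mono) auto
        also have "ennreal (1 / (v powr P * b v)) \<le> ennreal (v powr (- \<kappa>) * (K * t powr (\<kappa> - P) / b t))"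
        proof (rule ennreal_leI)
          have "1 = t powr (\<kappa> - P) / b t * (t powr (P - \<kappa>) * b t)"
            using bt by (simp flip: powr_add)
          also have "\<dots> \<le> t powr (\<kappa> - P) / b t * (K * (v powr (P - \<kappa>) * b v))"
            using weight[OF t v] bt by (intro mult_left_mono) (auto simp: P_def)
          also have "v powr (P - \<kappa>) = v powr P * v powr (- \<kappa>)"
            by (simp flip: powr_add)
          finally show "1 / (v powr P * b v) \<le> v powr (- \<kappa>) * (K * t powr (\<kappa> - P) / b t)"
            using bv by (simp add: pos_divide_le_eq ac_simps)
        qed
        also have "ennreal (v powr (- \<kappa>) * (K * t powr (\<kappa> - P) / b t)) * M = ennreal (v powr (- \<kappa>)) * X"
          using pos bt unfolding X_def
          by (subst ennreal_mult) (simp_all only: mult.assoc, auto)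
        finally show "F v \<le> ennreal (v powr (- \<kappa>)) * X"
          by (simp add: mult_right_mono)
      qed
    qed
    then have "avg u \<omega> (A t) F t \<le> avg u \<omega> (A t) (\<lambda>v. ennreal (v powr (- \<kappa>)) * X) t"
      using pos A[OF t] by (intro avg_mono) auto
    also have "\<dots> \<le> ennreal (C * t powr (- \<kappa>)) * X"
      by (rule bound[OF t])
    finally have "ennreal (t powr P * b t) * avg u \<omega> (A t) F t
        \<le> ennreal (t powr P * b t) * (ennreal (C * t powr (- \<kappa>)) * X)"
      by (rule mult_left_mono) simp
    also have "\<dots> = ennreal ((t powr P * b t) * (C * t powr (- \<kappa>)) * (K * t powr (\<kappa> - P) / b t)) * M"
      using pos bt unfolding X_def by (intro ennreal_mult_assoc3) auto
    also have "(t powr P * b t) * (C * t powr (- \<kappa>)) * (K * t powr (\<kappa> - P) / b t)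
        = C * K * (t powr P * t powr (- \<kappa>) * t powr (\<kappa> - P))"
      using bt by (simp add: field_simps)
    also have "t powr P * t powr (- \<kappa>) * t powr (\<kappa> - P) = 1"
      using bt by (simp flip: powr_add)
    finally show ?thesis by simp
  qed
  then have "AE t in lebesgue_on (ival L). ennreal (t powr P * b t) * avg u \<omega> (A t) F t \<le> ennreal (C * K) * M"
    by (intro AE_I2) auto
  then have "esssup (lebesgue_on (ival L)) (\<lambda>t. ennreal (t powr P * b t) * avg u \<omega> (A t) F t) \<le> ennreal (C * K) * M"
    by (intro esssup_I borel_measurable_times_ennreal weight_measurable b meas)
  then show ?thesis
    by (simp add: M_def B_norm_def Lq_norm_def recip_top[simplified] P_def)
qed

lemma avg_upper_measurable:
  assumes "0 < \<omega>"
  shows "(\<lambda>t. avg u \<omega> {0<..<t} F t) \<in> borel_measurable borel"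
proof -
  have "mono (\<lambda>t. epow (\<integral>\<^sup>+v\<in>{0<..<t}. ennreal (v powr (u * \<omega> - 1)) * epow (F v) \<omega> \<partial>lebesgue) (1 / \<omega>))"
    using assms by (auto simp: mono_def indicator_def intro!: epow_mono nn_integral_mono)
  note [measurable] = borel_measurable_mono_ennreal[OF this]
  show ?thesis unfolding avg_def by measurable
qed

lemma avg_lower_measurable:
  assumes "0 < \<omega>"
  shows "(\<lambda>t. avg u \<omega> (ival L \<inter> {t<..}) F t) \<in> borel_measurable borel"
proof -
  have "antimono (\<lambda>t. epow (\<integral>\<^sup>+v\<in>ival L \<inter> {t<..}. ennreal (v powr (u * \<omega> - 1)) * epow (F v) \<omega> \<partial>lebesgue) (1 / \<omega>))"
    using assms by (auto simp: antimono_def indicator_def intro!: epow_mono nn_integral_mono)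
  note [measurable] = borel_measurable_antimono_ennreal[OF this]
  show ?thesis unfolding avg_def by measurable
qed

lemma powr_weight_le:
  fixes s t x y a C \<rho> :: real
  assumes "s powr a * x \<le> C * (t powr a * y)" "0 < \<rho>" "0 \<le> C" "0 \<le> x" "0 \<le> y"
  shows "s powr (a * \<rho>) * x powr \<rho> \<le> C powr \<rho> * (t powr (a * \<rho>) * y powr \<rho>)"
proof -
  have "(s powr a * x) powr \<rho> \<le> (C * (t powr a * y)) powr \<rho>"
    using assms by (intro powr_mono2) auto
  then show ?thesis
    using assms by (simp add: powr_mult powr_powr)
qed

text \<open>The gap between \<kappa> and \<open>u\<close> makes the inner integral converge at 0. In
  the kernel integral \<open>t\<close> runs from \<open>x\<close> to infinity, and the gap between
  1/p and \<kappa>, which is 2 \<epsilon>, makes the exponent of \<open>t\<close> there less than -1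
  even after half of the gap is given to \<open>b\<close>.\<close>

lemma hardy_upper:
  assumes b: "b \<in> SV L" and r: "0 < r" and \<omega>: "0 < \<omega>" and u: "recip p < u"
  shows "\<exists>K\<ge>0. \<forall>F. antimono F \<longrightarrow>
    B_norm L p r b (\<lambda>t. avg u \<omega> {0<..<t} F t) \<le> ennreal K * B_norm L p r b F"
proof -
  define \<kappa> where "\<kappa> = (recip p + u) / 2"
  define \<epsilon> where "\<epsilon> = (\<kappa> - recip p) / 2"
  have \<kappa>: "recip p < \<kappa>" "\<kappa> < u" "0 < \<kappa>" and \<epsilon>: "0 < \<epsilon>"
    using u recip_nonneg[of p] by (auto simp: \<kappa>_def \<epsilon>_def field_simps)
  define C where "C = (1 / ((u - \<kappa>) * \<omega>)) powr (1 / \<omega>)"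
  have C: "0 \<le> C" by (simp add: C_def)
  have bound: "avg u \<omega> {0<..<t} (\<lambda>v. ennreal (v powr (- \<kappa>)) * X) t \<le> ennreal (C * t powr (- \<kappa>)) * X"
    if "t \<in> ival L" for t X
    unfolding C_def using ival_pos[OF that] \<omega> \<kappa> by (subst avg_upper_powr) auto
  have sub: "{0<..<t} \<subseteq> ival L" if "t \<in> ival L" for t
    using ival_down[OF that] by auto
  show ?thesis
  proof (cases "r = \<infinity>")
    case True
    \<comment> \<open>There is no outer integral when \<open>r\<close> is infinite, so the whole gap
      can be used in the comparison for \<open>b\<close>.\<close>
    have \<epsilon>2: "0 < 2 * \<epsilon>" "- (2 * \<epsilon>) = recip p - \<kappa>" using \<epsilon> by (auto simp: \<epsilon>_def field_simps)
    obtain K where K: "0 < K" "\<And>s t. t \<in> ival L \<Longrightarrow> 0 < s \<Longrightarrow> s \<le> t \<Longrightarrow>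
        t powr (recip p - \<kappa>) * b t \<le> K * (s powr (recip p - \<kappa>) * b s)"
      using SV_comparison[OF b \<epsilon>2(1)] unfolding \<epsilon>2(2) by metis
    have "B_norm L p \<infinity> b (\<lambda>t. avg u \<omega> {0<..<t} F t) \<le> ennreal (C * K) * B_norm L p \<infinity> b F" for F
      by (rule hardy_infinite[where \<kappa> = \<kappa>])
        (use \<omega> C K b sub bound in \<open>auto intro: lebesgue_on_borel avg_upper_measurable\<close>)
    then show ?thesis
      unfolding True using C K(1) by (intro exI[of _ "C * K"]) auto
  next
    case False
    then obtain \<rho> where \<rho>: "r = ennreal \<rho>" "0 < \<rho>" using r by (cases r) auto
    obtain K where K: "0 < K" "\<And>s t. t \<in> ival L \<Longrightarrow> 0 < s \<Longrightarrow> s \<le> t \<Longrightarrow>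
        t powr (- \<epsilon>) * b t \<le> K * (s powr (- \<epsilon>) * b s)"
      using SV_comparison[OF b \<epsilon>] by metis
    have \<epsilon>\<rho>: "- (\<epsilon> * \<rho>) < 0" using \<epsilon> \<rho> by simp
    define K' where "K' = K powr \<rho> / (\<epsilon> * \<rho>)"
    have K': "0 \<le> K'" using \<epsilon> \<rho> by (simp add: K'_def)
    have weight: "(\<integral>\<^sup>+t\<in>ival L. ennreal (t powr ((recip p - \<kappa>) * \<rho> - 1) * b t powr \<rho>) * indicator {0<..<t} x \<partial>lebesgue)
        \<le> ennreal (K' * (x powr ((recip p - \<kappa>) * \<rho>) * b x powr \<rho>))" if x: "x \<in> ival L" for x
    proof -
      have x0: "0 < x" "0 < b x" using ival_pos[OF x] SV_pos[OF b x] .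
      define X where "X = K powr \<rho> * (x powr (- \<epsilon> * \<rho>) * b x powr \<rho>)"
      \<comment> \<open>One half of the exponent is paired with \<open>b\<close> and compared with
        its value at \<open>x\<close>; the other half stays for the integral over t > x.\<close>
      have eq: "(recip p - \<kappa>) * \<rho> - 1 = (- (\<epsilon> * \<rho>) - 1) + (- \<epsilon>) * \<rho>"
        "(recip p - \<kappa>) * \<rho> = - \<epsilon> * \<rho> + - (\<epsilon> * \<rho>)"
        by (simp_all add: \<epsilon>_def field_simps)
      have "(\<integral>\<^sup>+t\<in>ival L. ennreal (t powr ((recip p - \<kappa>) * \<rho> - 1) * b t powr \<rho>) * indicator {0<..<t} x \<partial>lebesgue)
          \<le> (\<integral>\<^sup>+t. ennreal X * (ennreal (t powr (- (\<epsilon> * \<rho>) - 1)) * indicator {x<..} t) \<partial>lebesgue)"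
      proof (intro nn_integral_mono)
        fix t :: real
        have "t powr ((recip p - \<kappa>) * \<rho> - 1) * b t powr \<rho> \<le> X * t powr (- (\<epsilon> * \<rho>) - 1)"
          if t: "t \<in> ival L" "x < t"
        proof -
          have "t powr (- \<epsilon> * \<rho>) * b t powr \<rho> \<le> X"
            unfolding X_def using K x0 t SV_pos[OF b t(1)] \<rho>(2)
            by (intro powr_weight_le) auto
          then have "t powr (- (\<epsilon> * \<rho>) - 1) * (t powr (- \<epsilon> * \<rho>) * b t powr \<rho>) \<le> t powr (- (\<epsilon> * \<rho>) - 1) * X"
            by (rule mult_left_mono) simp
          then show ?thesis
            unfolding eq(1) powr_add by (simp add: ac_simps)
        qed
        then show "ennreal (t powr ((recip p - \<kappa>) * \<rho> - 1) * b t powr \<rho>) * indicator {0<..<t} x * indicator (ival L) t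
            \<le> ennreal X * (ennreal (t powr (- (\<epsilon> * \<rho>) - 1)) * indicator {x<..} t)"
          by (auto simp: indicator_def X_def simp flip: ennreal_mult intro!: ennreal_leI)
      qed
      also have "\<dots> = ennreal X * (\<integral>\<^sup>+t\<in>{x<..}. ennreal (t powr (- (\<epsilon> * \<rho>) - 1)) \<partial>lebesgue)"
        by (intro nn_integral_cmult borel_imp_lebesgue_measurable) measurable
      also have "\<dots> = ennreal X * ennreal (x powr (- (\<epsilon> * \<rho>)) / (\<epsilon> * \<rho>))"
        using nn_integral_powr_to_inf[OF \<epsilon>\<rho> x0(1)] by simp
      also have "\<dots> = ennreal (K' * (x powr (- \<epsilon> * \<rho>) * x powr (- (\<epsilon> * \<rho>)) * b x powr \<rho>))"
        using \<epsilon> \<rho> by (simp add: X_def K'_def field_simps flip: ennreal_mult)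
      also have "x powr (- \<epsilon> * \<rho>) * x powr (- (\<epsilon> * \<rho>)) = x powr ((recip p - \<kappa>) * \<rho>)"
        unfolding eq(2) powr_add ..
      finally show ?thesis .
    qed
    have "B_norm L p (ennreal \<rho>) b (\<lambda>t. avg u \<omega> {0<..<t} F t) \<le>
      ennreal ((C powr \<rho> * (\<kappa> * \<rho> / (1 - 2 powr (- (\<kappa> * \<rho>)))) * K') powr (1 / \<rho>)) * B_norm L p (ennreal \<rho>) b F"
      if F: "antimono F" for F
    proof (rule hardy_finite[OF F \<omega> \<rho>(2) \<kappa>(3) C K' b, where E = "\<lambda>t. {0<..<t}"])
      show "{(t :: real, x :: real). x \<in> {0<..<t}} \<in> sets (borel \<Otimes>\<^sub>M borel)"
      proof -
        have "{z \<in> space (borel \<Otimes>\<^sub>M borel). 0 < snd z \<and> snd z < fst z} \<in> sets ((borel :: real measure) \<Otimes>\<^sub>M (borel :: real measure))"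
          by measurable
        then show ?thesis by (simp add: space_pair_measure case_prod_unfold)
      qed
    qed (use sub bound weight in auto)
    then show ?thesis
      unfolding \<rho>(1) by (meson powr_ge_zero)
  qed
qed

text \<open>The mirror image of \<open>hardy_upper\<close>, with one complication. The intervals
  (v/2, v) with v > t reach down to t/2, so \<open>E t\<close> starts at t/2. In the kernel integral
  \<open>t\<close> then runs over (0, 2x), and \<open>b\<close> must be controlled on both sides of
  \<open>x\<close>.\<close>

lemma hardy_lower:
  assumes b: "b \<in> SV L" and r: "0 < r" and \<omega>: "0 < \<omega>" and u: "0 \<le> u" "u < recip p"
  shows "\<exists>K\<ge>0. \<forall>F. antimono F \<longrightarrow>
    B_norm L p r b (\<lambda>t. avg u \<omega> (ival L \<inter> {t<..}) F t) \<le> ennreal K * B_norm L p r b F"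
proof -
  define \<kappa> where "\<kappa> = (recip p + u) / 2"
  define \<epsilon> where "\<epsilon> = (recip p - \<kappa>) / 2"
  have \<kappa>: "\<kappa> < recip p" "u < \<kappa>" "0 < \<kappa>" and \<epsilon>: "0 < \<epsilon>"
    using u by (auto simp: \<kappa>_def \<epsilon>_def field_simps)
  define C where "C = (1 / ((\<kappa> - u) * \<omega>)) powr (1 / \<omega>)"
  have C: "0 \<le> C" by (simp add: C_def)
  have bound: "avg u \<omega> (ival L \<inter> {t<..}) (\<lambda>v. ennreal (v powr (- \<kappa>)) * X) t \<le> ennreal (C * t powr (- \<kappa>)) * X"
    if "t \<in> ival L" for t X
    unfolding C_def using ival_pos[OF that] \<omega> \<kappa> by (intro avg_lower_powr_le) auto
  have Im: "ival L \<inter> {t<..} \<in> sets lebesgue" for t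
    by (intro sets.Int) auto
  show ?thesis
  proof (cases "r = \<infinity>")
    case True
    have \<epsilon>2: "0 < 2 * \<epsilon>" "2 * \<epsilon> = recip p - \<kappa>" using \<epsilon> by (auto simp: \<epsilon>_def)
    obtain K where K: "0 < K" "\<And>s t. t \<in> ival L \<Longrightarrow> 0 < s \<Longrightarrow> s \<le> t \<Longrightarrow>
        s powr (recip p - \<kappa>) * b s \<le> K * (t powr (recip p - \<kappa>) * b t)"
      using SV_comparison[OF b \<epsilon>2(1)] unfolding \<epsilon>2(2) by metis
    have "B_norm L p \<infinity> b (\<lambda>t. avg u \<omega> (ival L \<inter> {t<..}) F t) \<le> ennreal (C * K) * B_norm L p \<infinity> b F" for F
      by (rule hardy_infinite[where \<kappa> = \<kappa>])
        (use \<omega> C K b Im bound in \<open>auto intro: lebesgue_on_borel avg_lower_measurable dest: ival_pos\<close>)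
    then show ?thesis
      unfolding True using C K(1) by (intro exI[of _ "C * K"]) auto
  next
    case False
    then obtain \<rho> where \<rho>: "r = ennreal \<rho>" "0 < \<rho>" using r by (cases r) auto
    obtain K where K: "0 < K"
      "\<And>s t. t \<in> ival L \<Longrightarrow> 0 < s \<Longrightarrow> s \<le> t \<Longrightarrow> s powr \<epsilon> * b s \<le> K * (t powr \<epsilon> * b t)"
      "\<And>s t. t \<in> ival L \<Longrightarrow> 0 < s \<Longrightarrow> s \<le> t \<Longrightarrow> t powr (- \<epsilon>) * b t \<le> K * (s powr (- \<epsilon>) * b s)"
      using SV_comparison[OF b \<epsilon>] by metis
    \<comment> \<open>For t between x and 2x the growth of \<open>t powr \<epsilon> * b t\<close> is
      not limited by the first comparison. It is written as \<open>t powr (2 * \<epsilon>)\<close>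
      times \<open>t powr (- \<epsilon>) * b t\<close>: the second comparison handles the latter
      factor, and doubling \<open>x\<close> costs \<open>2 powr (2 * \<epsilon>)\<close> in the
      former.\<close>
    define K2 where "K2 = K * 2 powr (2 * \<epsilon>)"
    have K2: "0 < K2" "K \<le> K2"
      using K(1) \<epsilon> by (auto simp: K2_def ge_one_powr_ge_zero)
    have cmp: "t powr \<epsilon> * b t \<le> K2 * (x powr \<epsilon> * b x)"
      if "x \<in> ival L" "t \<in> ival L" "t < 2 * x" for x t
    proof (cases "t \<le> x")
      case True
      have "t powr \<epsilon> * b t \<le> K * (x powr \<epsilon> * b x)"
        using K(2)[OF that(1) ival_pos[OF that(2)] True] .
      also have "\<dots> \<le> K2 * (x powr \<epsilon> * b x)"
        using K2 SV_pos[OF b that(1)] by (intro mult_right_mono) auto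
      finally show ?thesis .
    next
      case False
      have x: "0 < x" "0 < b x" using ival_pos[OF that(1)] SV_pos[OF b that(1)] .
      have t: "0 < t" "0 < b t" using ival_pos[OF that(2)] SV_pos[OF b that(2)] .
      have "t powr \<epsilon> * b t = t powr (2 * \<epsilon>) * (t powr (- \<epsilon>) * b t)"
        by (simp add: mult.assoc[symmetric] flip: powr_add)
      also have "\<dots> \<le> (2 * x) powr (2 * \<epsilon>) * (K * (x powr (- \<epsilon>) * b x))"
        using K(3)[OF that(2) x(1)] False t that \<epsilon> by (intro mult_mono[OF powr_mono2]) auto
      also have "\<dots> = K2 * ((x powr (2 * \<epsilon>) * x powr (- \<epsilon>)) * b x)"
        using x by (simp add: K2_def powr_mult)
      also have "x powr (2 * \<epsilon>) * x powr (- \<epsilon>) = x powr \<epsilon>"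
        by (simp flip: powr_add)
      finally show ?thesis .
    qed
    have \<epsilon>\<rho>: "0 < \<epsilon> * \<rho>" using \<epsilon> \<rho> by simp
    define K' where "K' = K2 powr \<rho> * 2 powr (\<epsilon> * \<rho>) / (\<epsilon> * \<rho>)"
    have K': "0 \<le> K'" using \<epsilon> \<rho> by (simp add: K'_def)
    have weight: "(\<integral>\<^sup>+t\<in>ival L. ennreal (t powr ((recip p - \<kappa>) * \<rho> - 1) * b t powr \<rho>) * indicator {t/2<..} x \<partial>lebesgue)
        \<le> ennreal (K' * (x powr ((recip p - \<kappa>) * \<rho>) * b x powr \<rho>))" if x: "x \<in> ival L" for x
    proof -
      have x0: "0 < x" "0 < b x" using ival_pos[OF x] SV_pos[OF b x] .
      define X where "X = K2 powr \<rho> * (x powr (\<epsilon> * \<rho>) * b x powr \<rho>)"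
      have eq: "(recip p - \<kappa>) * \<rho> - 1 = (\<epsilon> * \<rho> - 1) + \<epsilon> * \<rho>"
        "(recip p - \<kappa>) * \<rho> = \<epsilon> * \<rho> + \<epsilon> * \<rho>"
        by (simp_all add: \<epsilon>_def field_simps)
      have "(\<integral>\<^sup>+t\<in>ival L. ennreal (t powr ((recip p - \<kappa>) * \<rho> - 1) * b t powr \<rho>) * indicator {t/2<..} x \<partial>lebesgue)
          \<le> (\<integral>\<^sup>+t. ennreal X * (ennreal (t powr (\<epsilon> * \<rho> - 1)) * indicator {0<..<2 * x} t) \<partial>lebesgue)"
      proof (intro nn_integral_mono)
        fix t :: real
        have "t powr ((recip p - \<kappa>) * \<rho> - 1) * b t powr \<rho> \<le> X * t powr (\<epsilon> * \<rho> - 1)"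
          if t: "t \<in> ival L" "t < 2 * x"
        proof -
          have "t powr (\<epsilon> * \<rho>) * b t powr \<rho> \<le> X"
            unfolding X_def using K2 cmp[OF x t] x0 SV_pos[OF b t(1)] \<rho>(2)
            by (intro powr_weight_le) auto
          then have "t powr (\<epsilon> * \<rho> - 1) * (t powr (\<epsilon> * \<rho>) * b t powr \<rho>) \<le> t powr (\<epsilon> * \<rho> - 1) * X"
            by (rule mult_left_mono) simp
          then show ?thesis
            unfolding eq(1) powr_add by (simp add: ac_simps)
        qed
        then show "ennreal (t powr ((recip p - \<kappa>) * \<rho> - 1) * b t powr \<rho>) * indicator {t/2<..} x * indicator (ival L) t
            \<le> ennreal X * (ennreal (t powr (\<epsilon> * \<rho> - 1)) * indicator {0<..<2 * x} t)"
          using ival_pos[of t L]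
          by (auto simp: indicator_def X_def simp flip: ennreal_mult intro!: ennreal_leI)
      qed
      also have "\<dots> = ennreal X * (\<integral>\<^sup>+t\<in>{0<..<2 * x}. ennreal (t powr (\<epsilon> * \<rho> - 1)) \<partial>lebesgue)"
        by (intro nn_integral_cmult borel_imp_lebesgue_measurable) measurable
      also have "\<dots> = ennreal X * ennreal ((2 * x) powr (\<epsilon> * \<rho>) / (\<epsilon> * \<rho>))"
        using nn_integral_powr_from_0[OF \<epsilon>\<rho>, of "2 * x"] x0 by simp
      also have "\<dots> = ennreal (K' * (x powr (\<epsilon> * \<rho>) * x powr (\<epsilon> * \<rho>) * b x powr \<rho>))"
        using \<epsilon> \<rho> x0 by (simp add: X_def K'_def field_simps powr_mult flip: ennreal_mult)
      also have "x powr (\<epsilon> * \<rho>) * x powr (\<epsilon> * \<rho>) = x powr ((recip p - \<kappa>) * \<rho>)"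
        unfolding eq(2) powr_add ..
      finally show ?thesis .
    qed
    have "B_norm L p (ennreal \<rho>) b (\<lambda>t. avg u \<omega> (ival L \<inter> {t<..}) F t) \<le>
      ennreal ((C powr \<rho> * (\<kappa> * \<rho> / (1 - 2 powr (- (\<kappa> * \<rho>)))) * K') powr (1 / \<rho>)) * B_norm L p (ennreal \<rho>) b F"
      if F: "antimono F" for F
    proof (rule hardy_finite[OF F \<omega> \<rho>(2) \<kappa>(3) C K' b, where E = "\<lambda>t. {t/2<..}"])
      show "{(t :: real, x :: real). x \<in> {t/2<..}} \<in> sets (borel \<Otimes>\<^sub>M borel)"
      proof -
        have "{z \<in> space (borel \<Otimes>\<^sub>M borel). fst z / 2 < snd z} \<in> sets ((borel :: real measure) \<Otimes>\<^sub>M (borel :: real measure))"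
          by measurable
        then show ?thesis by (simp add: space_pair_measure case_prod_unfold)
      qed
    qed (use Im bound weight in auto)
    then show ?thesis
      unfolding \<rho>(1) by (meson powr_ge_zero)
  qed
qed

section \<open>Lower bounds for the averages\<close>

text \<open>On (0, t) the function is at least its value at \<open>t\<close>, and the average of a
  constant is \<open>avg_upper_powr\<close> with \<kappa> = 0.\<close>

lemma avg_upper_ge:
  assumes F: "antimono F" and "0 < \<omega>" "0 < u" "0 < t"
  shows "ennreal ((1 / (u * \<omega>)) powr (1 / \<omega>)) * F t \<le> avg u \<omega> {0<..<t} F t"
proof -
  have "ennreal ((1 / (u * \<omega>)) powr (1 / \<omega>)) * F t = avg u \<omega> {0<..<t} (\<lambda>v. ennreal (v powr (- 0)) * F t) t"
    using assms avg_upper_powr[of \<omega> 0 u t "F t"] by simp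
  also have "\<dots> \<le> avg u \<omega> {0<..<t} F t"
    using assms by (intro avg_mono) (auto simp: antimono_def)
  finally show ?thesis .
qed

text \<open>The average at \<open>t\<close> sees only values beyond \<open>t\<close>, and on (t, 2t)
  these are at least F(2t). For \<open>u = 0\<close>, that is infinite \<open>V\<close>, averaging a
  constant would produce a logarithm. The factor v / (2t), at most 1 on this interval, is therefore
  inserted; it raises the exponent to (u + 1) \<omega>, which is positive in all cases.\<close>

lemma avg_lower_ge:
  assumes F: "antimono F" and "0 < \<omega>" "0 \<le> u" "2 * t \<in> ival L"
  shows "ennreal (((2 powr ((u + 1) * \<omega>) - 1) / ((u + 1) * \<omega>)) powr (1 / \<omega>) / 2) * F (2 * t)
    \<le> avg u \<omega> (ival L \<inter> {t<..}) F t"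
proof -
  define \<alpha> where "\<alpha> = (u + 1) * \<omega>"
  have \<alpha>: "0 < \<alpha>" using assms by (simp add: \<alpha>_def)
  have t: "0 < t" using ival_pos[OF assms(4)] by simp
  define c where "c = (2 powr \<alpha> - 1) / \<alpha>"
  have c: "0 \<le> c" using \<alpha> by (simp add: c_def ge_one_powr_ge_zero)
  define X where "X = ennreal (1 / (2 * t)) * F (2 * t)"
  have "ennreal (c powr (1 / \<omega>) / 2) * F (2 * t) = ennreal (c powr (1 / \<omega>) * t) * X"
    using t c by (simp add: X_def mult.assoc[symmetric] flip: ennreal_mult)
  also have "c powr (1 / \<omega>) * t = t powr (- u) * (c powr (1 / \<omega>) * t powr (u + 1))"
    using t powr_add[of t "- u" "u + 1"] by simp
  also have "ennreal \<dots> = ennreal (t powr (- u)) * epow (ennreal (c * t powr \<alpha>)) (1 / \<omega>)"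
    using c assms by (simp add: epow_ennreal powr_mult powr_powr \<alpha>_def flip: ennreal_mult)
  also have "c * t powr \<alpha> = ((2 * t) powr \<alpha> - t powr \<alpha>) / \<alpha>"
    using t by (simp add: c_def powr_mult field_simps)
  also have "ennreal \<dots> = (\<integral>\<^sup>+v\<in>{t<..<2 * t}. ennreal (v powr (\<alpha> - 1)) \<partial>lebesgue)"
    using \<alpha> t by (intro nn_integral_powr_Ioo[symmetric]) auto
  also have "ennreal (t powr (- u)) * epow \<dots> (1 / \<omega>) * X
      = avg u \<omega> {t<..<2 * t} (\<lambda>v. ennreal (v powr (- (- 1))) * X) t"
    using assms t by (subst avg_powr) (auto simp: \<alpha>_def)
  also have "\<dots> \<le> avg u \<omega> (ival L \<inter> {t<..}) F t"
  proof (intro avg_mono AE_I2 impI)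
    show "{t<..<2 * t} \<subseteq> ival L \<inter> {t<..}"
      using t ival_down[OF assms(4)] by auto
    fix v assume v: "v \<in> {t<..<2 * t}"
    have "ennreal (v powr (- (- 1))) * X = ennreal (v * (1 / (2 * t))) * F (2 * t)"
      unfolding X_def mult.assoc[symmetric] using v t by (subst ennreal_mult) auto
    also have "\<dots> \<le> 1 * F (2 * t)"
      using v t by (intro mult_right_mono) auto
    also have "\<dots> \<le> F v"
      using F v by (auto simp: antimono_def)
    finally show "ennreal (v powr (- (- 1))) * X \<le> F v" .
  qed (use assms in auto)
  finally show ?thesis
    by (simp only: c_def \<alpha>_def)
qed

section \<open>Doubling and the passage from F(2t) back to F(t)\<close>

lemma powr_comparable:
  fixes s t x :: real
  assumes "0 < t" "t \<le> s" "s \<le> 4 * t"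
  shows "s powr x \<le> 4 powr \<bar>x\<bar> * t powr x"
proof (cases "0 \<le> x")
  case True
  then have "s powr x \<le> (4 * t) powr x"
    using assms by (intro powr_mono2) auto
  then show ?thesis using True by (simp add: powr_mult)
next
  case False
  then have "s powr x \<le> 1 * t powr x"
    using assms by (simp add: powr_mono2')
  also have "\<dots> \<le> 4 powr \<bar>x\<bar> * t powr x"
    by (intro mult_right_mono ge_one_powr_ge_zero) auto
  finally show ?thesis .
qed

text \<open>Slow variation is needed for the exponent 1 only: the remaining power with exponent
  \<open>x + 1\<close> changes by a bounded factor when \<open>s\<close> and \<open>t\<close> differ
  by a factor of at most 4.\<close>

lemma SV_doubling:
  assumes b: "b \<in> SV L"
  obtains C where "0 < C"
    "\<And>s t. s \<in> ival L \<Longrightarrow> t \<le> s \<Longrightarrow> s \<le> 4 * t \<Longrightarrow> s powr x * b s \<le> C * (t powr x * b t)"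
proof -
  obtain K where K: "0 < K"
    "\<And>s t. t \<in> ival L \<Longrightarrow> 0 < s \<Longrightarrow> s \<le> t \<Longrightarrow> t powr (- 1) * b t \<le> K * (s powr (- 1) * b s)"
    using SV_comparison[OF b zero_less_one] by metis
  show ?thesis
  proof (rule that[of "4 powr \<bar>x + 1\<bar> * K"])
    fix s t assume st: "s \<in> ival L" "t \<le> s" "s \<le> 4 * t"
    have t: "0 < t" "0 < b t" "0 < s" "0 < b s"
      using ival_pos[OF st(1)] st SV_pos[OF b] ival_down[OF st(1)] by auto
    have "s powr x * b s = s powr (x + 1) * (s powr (- 1) * b s)"
      by (simp only: mult.assoc[symmetric] powr_add[symmetric]) simp
    also have "\<dots> \<le> (4 powr \<bar>x + 1\<bar> * t powr (x + 1)) * (K * (t powr (- 1) * b t))"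
      using K(2)[OF st(1) t(1) st(2)] powr_comparable[OF t(1) st(2,3)] t K(1)
      by (intro mult_mono[of "s powr (x + 1)"]) auto
    also have "\<dots> = 4 powr \<bar>x + 1\<bar> * K * ((t powr (x + 1) * t powr (- 1)) * b t)"
      by (simp only: ac_simps)
    also have "t powr (x + 1) * t powr (- 1) = t powr x"
      by (simp only: powr_add[symmetric]) simp
    finally show "s powr x * b s \<le> 4 powr \<bar>x + 1\<bar> * K * (t powr x * b t)" .
  qed (use K in auto)
qed

lemma AE_lebesgue_Ioo_ex:
  fixes a b :: real
  assumes "AE x in lebesgue. Q x" "a < b"
  shows "\<exists>x. a < x \<and> x < b \<and> Q x"
proof (rule ccontr)
  assume *: "\<not> ?thesis"
  have "AE x in lebesgue. x \<notin> {a<..<b}"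
    using assms(1) by eventually_elim (use * in auto)
  then have "{a<..<b} \<in> null_sets lebesgue"
    by (subst AE_iff_null_sets) auto
  then have "emeasure lebesgue {a<..<b} = 0"
    by auto
  then show False using assms(2) by simp
qed

text \<open>The bound by the essential supremum of \<open>G\<close> holds only almost everywhere, so
  the point s/2 itself may be bad. A good point \<open>t\<close> is taken from (s/4, s/2) instead:
  there F(s) is at most F(2t), the weights are comparable, and 2t < s stays inside (0, L) even for
  \<open>s\<close> close to \<open>L\<close>.\<close>

lemma B_norm_le_dilation_infinite:
  assumes b: "b \<in> SV L" and c: "0 < c"
    and ge: "\<And>t. 2 * t \<in> ival L \<Longrightarrow> ennreal c * F (2 * t) \<le> G t" and F: "antimono F"
    and C: "0 < C" "\<And>s t. s \<in> ival L \<Longrightarrow> t \<le> s \<Longrightarrow> s \<le> 4 * t \<Longrightarrow> s powr recip p * b s \<le> C * (t powr recip p * b t)"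
  shows "B_norm L p \<infinity> b F \<le> ennreal (C / c) * B_norm L p \<infinity> b G"
proof -
  define M where "M = B_norm L p \<infinity> b G"
  let ?w = "\<lambda>t. t powr recip p * b t"
  have "AE t in lebesgue_on (ival L). ennreal (?w t) * G t \<le> M"
    using esssup_AE[of "\<lambda>v. ennreal (?w v) * G v" "lebesgue_on (ival L)"]
    by (simp add: M_def B_norm_def Lq_norm_def recip_top[simplified])
  then have AE: "AE t in lebesgue. t \<in> ival L \<longrightarrow> ennreal (?w t) * G t \<le> M"
    by (simp add: AE_restrict_space_iff)
  have "ennreal (?w s) * F s \<le> ennreal (C / c) * M" if s: "s \<in> ival L" for s
  proof -
    have s0: "0 < s" using ival_pos[OF s] .
    then have "s / 4 < s / 2" by simp
    from AE_lebesgue_Ioo_ex[OF AE this] obtain t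
      where t: "s / 4 < t" "t < s / 2" "t \<in> ival L \<Longrightarrow> ennreal (?w t) * G t \<le> M" by blast
    have tI: "t \<in> ival L" "2 * t \<in> ival L"
      using t s0 ival_down[OF s] by auto
    have w: "0 \<le> ?w t" using SV_pos[OF b tI(1)] by simp
    have "ennreal (?w s) * F s \<le> ennreal (C * ?w t) * F (2 * t)"
      using C(2)[OF s, of t] t F by (intro mult_mono[OF ennreal_leI]) (auto simp: antimono_def)
    also have "ennreal (C * ?w t) = ennreal (C / c) * ennreal (?w t) * ennreal c"
      using C c w by (simp flip: ennreal_mult)
    also have "ennreal (C / c) * ennreal (?w t) * ennreal c * F (2 * t)
        = ennreal (C / c) * (ennreal (?w t) * (ennreal c * F (2 * t)))"
      by (simp only: mult.assoc)
    also have "\<dots> \<le> ennreal (C / c) * (ennreal (?w t) * G t)"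
      using ge[OF tI(2)] by (intro mult_left_mono) auto
    also have "\<dots> \<le> ennreal (C / c) * M"
      using t(3)[OF tI(1)] by (intro mult_left_mono) auto
    finally show ?thesis .
  qed
  then have "AE s in lebesgue_on (ival L). ennreal (?w s) * F s \<le> ennreal (C / c) * M"
    by (intro AE_I2) auto
  then have "esssup (lebesgue_on (ival L)) (\<lambda>s. ennreal (?w s) * F s) \<le> ennreal (C / c) * M"
    by (intro esssup_I borel_measurable_times_ennreal weight_measurable b lebesgue_on_borel
        borel_measurable_antimono_ennreal F)
  then show ?thesis
    by (simp add: M_def B_norm_def Lq_norm_def recip_top[simplified])
qed

text \<open>Instead of substituting s = 2t, the estimate at \<open>s\<close> is averaged over all
  \<open>t\<close> in (s/4, s/2). This keeps 2t below \<open>s\<close>, and Tonelli in the form of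
  \<open>kernel_integral_le\<close> then moves the integral from \<open>s\<close> to
  \<open>t\<close>.\<close>

lemma B_norm_le_dilation_finite:
  assumes b: "b \<in> SV L" and c: "0 < c" and \<rho>: "0 < \<rho>"
    and ge: "\<And>t. 2 * t \<in> ival L \<Longrightarrow> ennreal c * F (2 * t) \<le> G t" and F: "antimono F"
    and G: "G \<in> borel_measurable borel"
    and C: "0 < C" "\<And>s t. s \<in> ival L \<Longrightarrow> t \<le> s \<Longrightarrow> s \<le> 4 * t \<Longrightarrow>
      s powr (recip p * \<rho> - 1) * b s powr \<rho> \<le> C * (t powr (recip p * \<rho> - 1) * b t powr \<rho>)"
  shows "B_norm L p (ennreal \<rho>) b F \<le> ennreal ((4 * C) powr (1 / \<rho>) / c) * B_norm L p (ennreal \<rho>) b G"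
proof -
  define w where "w t = t powr (recip p * \<rho> - 1) * b t powr \<rho>" for t
  have w: "0 \<le> w t" for t by (simp add: w_def)
  have wm: "(\<lambda>t. ennreal (w t)) \<in> borel_measurable (lebesgue_on (ival L))"
    unfolding w_def by (intro weight_measurable b)
  define J where "J = {t. 2 * t \<in> ival L}"
  have J: "J \<in> sets borel"
    using measurable_sets[of "\<lambda>t::real. 2 * t" borel borel "ival L"] by (simp add: J_def vimage_def)
  have Fm: "(\<lambda>t. epow (F (2 * t)) \<rho>) \<in> borel_measurable borel"
    by (rule borel_measurable_epow, rule measurable_compose[OF _ borel_measurable_antimono_ennreal[OF F]]) simp
  \<comment> \<open>The interval has length s/4, so 4/s normalizes the average; \<open>C\<close>
    pays for replacing the weight at \<open>s\<close> by the weight at \<open>t\<close>.\<close>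
  define k where "k s t = ennreal (4 * C / s) * indicator {s/4<..<s/2} t" for s t :: real
  let ?B = "\<lambda>t. ennreal (w t) * epow (F (2 * t)) \<rho> * indicator J t"
  have "(\<integral>\<^sup>+s\<in>ival L. 1 * (ennreal (w s) * epow (F s) \<rho>) \<partial>lebesgue) \<le> ennreal (4 * C) * (\<integral>\<^sup>+t\<in>ival L. 1 * ?B t \<partial>lebesgue)"
  proof (rule kernel_integral_le[where k = k, OF ival_lebesgue])
    show "(\<lambda>t. 1 * indicator (ival L) t :: ennreal) \<in> borel_measurable lebesgue"
      "(\<lambda>t. 1 * indicator (ival L) t :: ennreal) \<in> borel_measurable lebesgue"
      by (auto intro!: borel_measurable_indicator)
    have "(\<lambda>t. ennreal (w t) * indicator (ival L) t * (epow (F (2 * t)) \<rho> * indicator J t)) \<in> borel_measurable lebesgue"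
      by (intro borel_measurable_times_ennreal ennreal_indicator_measurable wm
          borel_imp_lebesgue_measurable[OF Fm] borel_imp_lebesgue_measurable[OF borel_measurable_indicator[OF J]]) simp
    then show "(\<lambda>t. ?B t * indicator (ival L) t) \<in> borel_measurable lebesgue"
      by (simp only: ac_simps)
    have "(\<lambda>(s, t). k s t) = (\<lambda>z. ennreal (4 * C / fst z) * indicator {z. fst z / 4 < snd z \<and> snd z < fst z / 2} z)"
      by (auto simp: k_def indicator_def)
    moreover have "{z \<in> space (borel \<Otimes>\<^sub>M borel). fst z / 4 < snd z \<and> snd z < fst z / 2} \<in> sets ((borel :: real measure) \<Otimes>\<^sub>M (borel :: real measure))"
      by measurable
    ultimately show "(\<lambda>(s, t). k s t) \<in> borel_measurable (borel \<Otimes>\<^sub>M borel)"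
      by (simp add: space_pair_measure)
  next
    fix s assume s: "s \<in> ival L"
    have s0: "0 < s" using ival_pos[OF s] .
    have "ennreal (w s) * epow (F s) \<rho> = ennreal (w s) * epow (F s) \<rho> * ennreal (4 / s) * ennreal (s / 4)"
      using s0 by (simp add: mult.assoc flip: ennreal_mult)
    also have "\<dots> = (\<integral>\<^sup>+t\<in>{s/4<..<s/2}. ennreal (w s) * epow (F s) \<rho> * ennreal (4 / s) \<partial>lebesgue)"
      using s0 by (subst nn_integral_cmult_indicator) auto
    also have "\<dots> \<le> (\<integral>\<^sup>+t\<in>ival L. k s t * ?B t \<partial>lebesgue)"
    proof (intro nn_integral_mono)
      fix t :: real
      have "ennreal (w s) * epow (F s) \<rho> * ennreal (4 / s) \<le> ennreal (4 * C / s) * (ennreal (w t) * epow (F (2 * t)) \<rho>)"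
        if t: "s / 4 < t" "t < s / 2"
      proof -
        have "ennreal (w s) * epow (F s) \<rho> * ennreal (4 / s) \<le> ennreal (C * w t) * epow (F (2 * t)) \<rho> * ennreal (4 / s)"
          using C(2)[OF s, of t] t F \<rho>
          by (intro mult_mono ennreal_leI epow_mono) (auto simp: antimono_def w_def)
        also have "\<dots> = ennreal (C * w t) * ennreal (4 / s) * epow (F (2 * t)) \<rho>"
          by (simp only: ac_simps)
        also have "ennreal (C * w t) * ennreal (4 / s) = ennreal (4 * C / s) * ennreal (w t)"
          using s0 C(1) w[of t] by (simp add: mult.commute flip: ennreal_mult)
        finally show ?thesis by (simp only: mult.assoc)
      qed
      moreover have "t \<in> ival L" "t \<in> J" if "s / 4 < t" "t < s / 2"
        using that s0 ival_down[OF s] by (auto simp: J_def)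
      ultimately show "ennreal (w s) * epow (F s) \<rho> * ennreal (4 / s) * indicator {s/4<..<s/2} t
          \<le> k s t * ?B t * indicator (ival L) t"
        by (auto simp: k_def indicator_def)
    qed
    finally show "ennreal (w s) * epow (F s) \<rho> \<le> (\<integral>\<^sup>+t\<in>ival L. k s t * ?B t \<partial>lebesgue)" .
  next
    fix t assume t: "t \<in> ival L"
    have t0: "0 < t" using ival_pos[OF t] .
    \<comment> \<open>For fixed \<open>t\<close> the kernel lives on 2t < s < 4t, an interval of
      length 2t on which it is at most 2C/t.\<close>
    have "(\<integral>\<^sup>+s\<in>ival L. 1 * k s t \<partial>lebesgue) \<le> (\<integral>\<^sup>+s\<in>{2 * t<..<4 * t}. ennreal (2 * C / t) \<partial>lebesgue)"
      using t0 C(1) by (intro nn_integral_mono) (auto simp: k_def indicator_def field_simps intro!: ennreal_leI)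
    also have "\<dots> = ennreal (2 * C / t) * ennreal (2 * t)"
      using t0 by (subst nn_integral_cmult_indicator) auto
    also have "\<dots> = ennreal (4 * C) * 1"
      using t0 C(1) by (simp flip: ennreal_mult)
    finally show "(\<integral>\<^sup>+s\<in>ival L. 1 * k s t \<partial>lebesgue) \<le> ennreal (4 * C) * 1" .
  qed
  also have "(\<integral>\<^sup>+t\<in>ival L. 1 * ?B t \<partial>lebesgue)
      \<le> (\<integral>\<^sup>+t. ennreal ((1 / c) powr \<rho>) * (ennreal (w t) * indicator (ival L) t * epow (G t) \<rho>) \<partial>lebesgue)"
  proof (intro nn_integral_mono)
    fix t :: real
    have "epow (F (2 * t)) \<rho> \<le> ennreal ((1 / c) powr \<rho>) * epow (G t) \<rho>" if "t \<in> J"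
    proof -
      have "F (2 * t) = ennreal (1 / c) * (ennreal c * F (2 * t))"
        using c by (simp add: mult.assoc[symmetric] flip: ennreal_mult)
      also have "\<dots> \<le> ennreal (1 / c) * G t"
        using that ge by (intro mult_left_mono) (auto simp: J_def)
      finally have "epow (F (2 * t)) \<rho> \<le> epow (ennreal (1 / c) * G t) \<rho>"
        using \<rho> by (intro epow_mono)
      then show ?thesis using c by (simp add: epow_mult epow_ennreal)
    qed
    then have "ennreal (w t) * epow (F (2 * t)) \<rho> \<le> ennreal (w t) * (ennreal ((1 / c) powr \<rho>) * epow (G t) \<rho>)" if "t \<in> J"
      using that by (intro mult_left_mono) auto
    then show "1 * ?B t * indicator (ival L) t
        \<le> ennreal ((1 / c) powr \<rho>) * (ennreal (w t) * indicator (ival L) t * epow (G t) \<rho>)"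
      by (auto simp: indicator_def mult.left_commute)
  qed
  also have "\<dots> = ennreal ((1 / c) powr \<rho>) * (\<integral>\<^sup>+t. ennreal (w t) * indicator (ival L) t * epow (G t) \<rho> \<partial>lebesgue)"
    by (intro nn_integral_cmult borel_measurable_times_ennreal ennreal_indicator_measurable wm
        borel_measurable_epow borel_imp_lebesgue_measurable[OF G]) simp
  also have "(\<integral>\<^sup>+t. ennreal (w t) * indicator (ival L) t * epow (G t) \<rho> \<partial>lebesgue)
      = (\<integral>\<^sup>+t\<in>ival L. ennreal (w t) * epow (G t) \<rho> \<partial>lebesgue)"
    by (simp only: ac_simps)
  finally have "(\<integral>\<^sup>+s\<in>ival L. ennreal (w s) * epow (F s) \<rho> \<partial>lebesgue) \<le>
    ennreal (4 * C) * (ennreal ((1 / c) powr \<rho>) * (\<integral>\<^sup>+t\<in>ival L. ennreal (w t) * epow (G t) \<rho> \<partial>lebesgue))"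
    by (simp add: mult_left_mono)
  then have "epow (\<integral>\<^sup>+s\<in>ival L. ennreal (w s) * epow (F s) \<rho> \<partial>lebesgue) (1 / \<rho>) \<le>
    epow (ennreal (4 * C) * (ennreal ((1 / c) powr \<rho>) * (\<integral>\<^sup>+t\<in>ival L. ennreal (w t) * epow (G t) \<rho> \<partial>lebesgue))) (1 / \<rho>)"
    using \<rho> by (intro epow_mono) auto
  also have "\<dots> = ennreal ((4 * C) powr (1 / \<rho>)) * (ennreal (1 / c) *
      epow (\<integral>\<^sup>+t\<in>ival L. ennreal (w t) * epow (G t) \<rho> \<partial>lebesgue) (1 / \<rho>))"
    using C(1) c \<rho> by (simp only: epow_mult) (simp add: epow_ennreal powr_powr)
  also have "\<dots> = ennreal ((4 * C) powr (1 / \<rho>) / c) *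
      epow (\<integral>\<^sup>+t\<in>ival L. ennreal (w t) * epow (G t) \<rho> \<partial>lebesgue) (1 / \<rho>)"
    using c by (simp add: mult.assoc[symmetric] flip: ennreal_mult)
  finally show ?thesis
    using \<rho> b by (simp add: B_norm_ennreal w_def)
qed

lemma B_norm_le_avg_lower:
  assumes b: "b \<in> SV L" and r: "0 < r" and \<omega>: "0 < \<omega>" and u: "0 \<le> u"
  shows "\<exists>K\<ge>0. \<forall>F. antimono F \<longrightarrow>
    B_norm L p r b F \<le> ennreal K * B_norm L p r b (\<lambda>t. avg u \<omega> (ival L \<inter> {t<..}) F t)"
proof -
  define c where "c = ((2 powr ((u + 1) * \<omega>) - 1) / ((u + 1) * \<omega>)) powr (1 / \<omega>) / 2"
  have "0 < (u + 1) * \<omega>" using u \<omega> by simp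
  then have c: "0 < c"
    using powr_less_mono[of 0 "(u + 1) * \<omega>" 2] u \<omega> by (simp add: c_def)
  have ge: "ennreal c * F (2 * t) \<le> avg u \<omega> (ival L \<inter> {t<..}) F t" if "antimono F" "2 * t \<in> ival L" for F t
    unfolding c_def by (intro avg_lower_ge that \<omega> u)
  show ?thesis
  proof (cases "r = \<infinity>")
    case True
    obtain C where C: "0 < C" "\<And>s t. s \<in> ival L \<Longrightarrow> t \<le> s \<Longrightarrow> s \<le> 4 * t \<Longrightarrow>
        s powr recip p * b s \<le> C * (t powr recip p * b t)"
      using SV_doubling[OF b, of "recip p"] by blast
    have "B_norm L p \<infinity> b F \<le> ennreal (C / c) * B_norm L p \<infinity> b (\<lambda>t. avg u \<omega> (ival L \<inter> {t<..}) F t)"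
      if "antimono F" for F
      by (rule B_norm_le_dilation_infinite[OF b c]) (use that ge C in auto)
    then show ?thesis
      unfolding True using C(1) c by (intro exI[of _ "C / c"]) auto
  next
    case False
    then obtain \<rho> where \<rho>: "r = ennreal \<rho>" "0 < \<rho>" using r by (cases r) auto
    obtain C where C: "0 < C" "\<And>s t. s \<in> ival L \<Longrightarrow> t \<le> s \<Longrightarrow> s \<le> 4 * t \<Longrightarrow>
        s powr (recip p - 1 / \<rho>) * b s \<le> C * (t powr (recip p - 1 / \<rho>) * b t)"
      using SV_doubling[OF b, of "recip p - 1 / \<rho>"] by blast
    have e: "(recip p - 1 / \<rho>) * \<rho> = recip p * \<rho> - 1"
      using \<rho> by (simp add: field_simps)
    have C': "s powr (recip p * \<rho> - 1) * b s powr \<rho> \<le> C powr \<rho> * (t powr (recip p * \<rho> - 1) * b t powr \<rho>)"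
      if st: "s \<in> ival L" "t \<le> s" "s \<le> 4 * t" for s t
    proof -
      have "t \<in> ival L" using ival_down[OF st(1)] ival_pos[OF st(1)] st by auto
      then show ?thesis
        using powr_weight_le[OF C(2)[OF st] \<rho>(2)] C(1) SV_pos[OF b] st(1) unfolding e
        by (auto simp: less_imp_le)
    qed
    have "B_norm L p (ennreal \<rho>) b F \<le> ennreal ((4 * C powr \<rho>) powr (1 / \<rho>) / c) *
        B_norm L p (ennreal \<rho>) b (\<lambda>t. avg u \<omega> (ival L \<inter> {t<..}) F t)"
      if "antimono F" for F
      by (rule B_norm_le_dilation_finite[OF b c \<rho>(2) _ that avg_lower_measurable[OF \<omega>] _ C'])
        (use that ge C in auto)
    then show ?thesis
      unfolding \<rho>(1) using c by (intro exI[of _ "(4 * C powr \<rho>) powr (1 / \<rho>) / c"]) auto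
  qed
qed

section \<open>Rearrangements of test functions\<close>

lemma rearr_antimono: "antimono (rearr L f)"
  unfolding antimono_def rearr_def
  by (intro allI impI Inf_superset_mono) (blast intro: order_trans ennreal_leI)

lemma level_set_lebesgue:
  assumes "f \<in> meas_fun L"
  shows "{x \<in> ival L. l < cmod (f x)} \<in> sets lebesgue"
proof -
  have [measurable]: "f \<in> borel_measurable (lebesgue_on (ival L))"
    using assms by (simp add: meas_fun_def)
  have "{x \<in> space (lebesgue_on (ival L)). l < cmod (f x)} \<in> sets (lebesgue_on (ival L))"
    by measurable
  then show ?thesis
    by (simp add: sets_restrict_space_iff)
qed

lemma rearr_ge:
  assumes f: "f \<in> meas_fun L" and "ennreal t < emeasure lebesgue {x \<in> ival L. l < cmod (f x)}"
  shows "ennreal l \<le> rearr L f t"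
  unfolding rearr_def
proof (rule Inf_greatest)
  fix x assume "x \<in> {ennreal l | l. 0 < l \<and> emeasure lebesgue {x \<in> ival L. l < cmod (f x)} \<le> ennreal t}"
  then obtain l' where l': "x = ennreal l'" "emeasure lebesgue {x \<in> ival L. l' < cmod (f x)} \<le> ennreal t"
    by blast
  show "ennreal l \<le> x"
  proof (rule ccontr)
    assume "\<not> ?thesis"
    then have "l' < l" by (metis ennreal_leI not_less l'(1))
    then have "emeasure lebesgue {x \<in> ival L. l < cmod (f x)} \<le> emeasure lebesgue {x \<in> ival L. l' < cmod (f x)}"
      by (intro emeasure_mono level_set_lebesgue[OF f]) auto
    then show False using l' assms(2) by simp
  qed
qed

text \<open>The set where \<open>g\<close> exceeds g(t) + e lies to the left of \<open>t\<close>, so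
  its measure is at most \<open>t\<close>. The extra \<open>e\<close> makes the level positive, as
  the definition of \<open>rearr\<close> demands even when g(t) = 0.\<close>

lemma rearr_antimono_le:
  assumes g: "antimono_on (ival L) g" "\<And>x. x \<in> ival L \<Longrightarrow> 0 \<le> g x" and t: "t \<in> ival L"
  shows "rearr L (\<lambda>x. complex_of_real (g x)) t \<le> ennreal (g t)"
proof (rule ennreal_le_epsilon)
  fix e :: real assume e: "0 < e"
  have "{x \<in> ival L. g t + e < cmod (complex_of_real (g x))} \<subseteq> {0<..<t}"
  proof
    fix x assume "x \<in> {x \<in> ival L. g t + e < cmod (complex_of_real (g x))}"
    then have x: "x \<in> ival L" "g t + e < \<bar>g x\<bar>" by auto
    have "x < t"
    proof (rule ccontr)
      assume "\<not> x < t"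
      then have "g x \<le> g t" using g(1) x t by (auto simp: monotone_on_def)
      then show False using g(2)[OF x(1)] x e by simp
    qed
    then show "x \<in> {0<..<t}" using ival_pos[OF x(1)] by simp
  qed
  then have "emeasure lebesgue {x \<in> ival L. g t + e < cmod (complex_of_real (g x))} \<le> emeasure lebesgue {0<..<t}"
    by (intro emeasure_mono) auto
  also have "\<dots> = ennreal t" using ival_pos[OF t] by simp
  finally have "rearr L (\<lambda>x. complex_of_real (g x)) t \<le> ennreal (g t + e)"
    unfolding rearr_def using e g(2)[OF t]
    by (intro Inf_lower CollectI exI[of _ "g t + e"] conjI refl) auto
  then show "rearr L (\<lambda>x. complex_of_real (g x)) t \<le> ennreal (g t) + ennreal e"
    using e g(2)[OF t] by simp
qed

text \<open>Continuity matters because at a jump the rearrangement takes the value from the right.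
  With continuity \<open>g\<close> still exceeds g(t) - e at some y > t, hence on all of (0, y), a
  set of measure larger than \<open>t\<close>.\<close>

lemma rearr_antimono_ge:
  assumes g: "antimono_on (ival L) g" "\<And>x. x \<in> ival L \<Longrightarrow> 0 \<le> g x" and t: "t \<in> ival L"
    and f: "(\<lambda>x. complex_of_real (g x)) \<in> meas_fun L" and cont: "isCont g t"
  shows "ennreal (g t) \<le> rearr L (\<lambda>x. complex_of_real (g x)) t"
proof (rule ennreal_le_epsilon)
  fix e :: real assume e: "0 < e"
  obtain d where d: "0 < d" "\<And>x. dist x t < d \<Longrightarrow> dist (g x) (g t) < e"
    using cont e unfolding continuous_at_eps_delta by blast
  obtain d' where d': "0 < d'" "{t..<t + d'} \<subseteq> ival L"
    using ival_upper_nbhd[OF t] .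
  define y where "y = t + min d d' / 2"
  have y: "t < y" "y \<in> ival L" "dist y t < d"
    using d d' by (auto simp: y_def dist_real_def subset_iff)
  have gy: "g t - e < g y"
    using d(2)[OF y(3)] by (simp add: dist_real_def)
  have "ennreal t < ennreal y"
    using y ival_pos[OF t] by (intro ennreal_lessI) auto
  also have "ennreal y = emeasure lebesgue {0<..<y}"
    using y ival_pos[OF t] by simp
  also have "\<dots> \<le> emeasure lebesgue {x \<in> ival L. g t - e < cmod (complex_of_real (g x))}"
  proof (intro emeasure_mono level_set_lebesgue[OF f], safe)
    fix x assume x: "x \<in> {0<..<y}"
    then show xI: "x \<in> ival L" using ival_down[OF y(2), of x] by auto
    have "g y \<le> g x" using g(1) xI x y by (auto simp: monotone_on_def)
    then show "g t - e < cmod (complex_of_real (g x))" using gy by simp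
  qed
  finally have "ennreal (g t - e) \<le> rearr L (\<lambda>x. complex_of_real (g x)) t"
    by (rule rearr_ge[OF f])
  then have "ennreal (g t - e) + ennreal e \<le> rearr L (\<lambda>x. complex_of_real (g x)) t + ennreal e"
    by (rule add_right_mono)
  moreover have "ennreal (g t) \<le> ennreal (g t - e) + ennreal e"
  proof (cases "0 \<le> g t - e")
    case True
    then show ?thesis using e by (simp flip: ennreal_plus)
  next
    case False
    then show ?thesis using e by (simp add: add_increasing ennreal_leI)
  qed
  ultimately show "ennreal (g t) \<le> rearr L (\<lambda>x. complex_of_real (g x)) t + ennreal e"
    by (rule order_trans[rotated])
qed

text \<open>The case \<open>s = 0\<close> is the pure power on \<open>(0, 1)\<close>; only positive arguments matter.\<close>

definition cut_powr :: "real \<Rightarrow> real \<Rightarrow> real \<Rightarrow> real" where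
  "cut_powr s a x = (if x < 1 then max s x powr (- a) else 0)"

lemma cut_powr_measurable [measurable]: "cut_powr s a \<in> borel_measurable borel"
  unfolding cut_powr_def by measurable

lemma cut_powr_nonneg: "0 \<le> cut_powr s a x"
  by (simp add: cut_powr_def)

lemma cut_powr_meas_fun: "(\<lambda>x. complex_of_real (cut_powr s a x)) \<in> meas_fun L"
  unfolding meas_fun_def by (intro measurable_restrict_space1 measurable_completion) measurable

lemma cut_powr_antimono:
  assumes "0 \<le> a"
  shows "antimono_on (ival L) (cut_powr s a)"
proof (rule monotone_onI)
  fix x y assume "x \<in> ival L" "y \<in> ival L" "x \<le> y"
  then show "cut_powr s a y \<le> cut_powr s a x"
    using ival_pos[of x L] assms by (auto simp: cut_powr_def intro!: powr_mono2')
qed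

text \<open>A non-increasing function is its own rearrangement wherever it is continuous. On the
  positive axis the only possible discontinuity is the jump at 1, and from there on the value is 0,
  so the lower bound is trivial.\<close>

lemma rearr_cut_powr:
  assumes a: "0 \<le> a" and t: "t \<in> ival L"
  shows "rearr L (\<lambda>x. complex_of_real (cut_powr s a x)) t = ennreal (cut_powr s a t)"
proof (rule antisym)
  show "rearr L (\<lambda>x. complex_of_real (cut_powr s a x)) t \<le> ennreal (cut_powr s a t)"
    by (intro rearr_antimono_le cut_powr_antimono cut_powr_nonneg a t)
  show "ennreal (cut_powr s a t) \<le> rearr L (\<lambda>x. complex_of_real (cut_powr s a x)) t"
  proof (cases "t < 1")
    case True
    have "isCont (\<lambda>x. max s x powr (- a)) t"
      using ival_pos[OF t] by (intro continuous_intros) auto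
    moreover have "eventually (\<lambda>x. max s x powr (- a) = cut_powr s a x) (nhds t)"
      using eventually_nhds_in_open[of "{..<1}" t] True
      by (auto elim!: eventually_mono simp: cut_powr_def)
    ultimately have "isCont (cut_powr s a) t"
      by (simp add: isCont_cong)
    then show ?thesis
      by (intro rearr_antimono_ge cut_powr_antimono cut_powr_nonneg cut_powr_meas_fun a t)
  qed (simp add: cut_powr_def)
qed

section \<open>Weighted norms of the test functions\<close>

lemma B_norm_mono:
  assumes "b \<in> SV L" "0 < r" "g \<in> borel_measurable (lebesgue_on (ival L))"
    "\<And>t. t \<in> ival L \<Longrightarrow> g t \<le> g' t"
  shows "B_norm L p r b g \<le> B_norm L p r b g'"
  unfolding B_norm_def using assms
  by (intro Lq_norm_mono borel_measurable_times_ennreal weight_measurable) (auto intro: mult_left_mono)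

lemma B_norm_cmult_le:
  assumes "b \<in> SV L" "0 < r" "g \<in> borel_measurable (lebesgue_on (ival L))"
  shows "B_norm L p r b (\<lambda>t. c * g t) \<le> c * B_norm L p r b g"
proof -
  have "B_norm L p r b (\<lambda>t. c * g t) = Lq_norm r (ival L) (\<lambda>t. c * (ennreal (t powr (recip p - recip r) * b t) * g t))"
    unfolding B_norm_def by (simp only: mult.left_commute)
  also have "\<dots> \<le> c * B_norm L p r b g"
    unfolding B_norm_def using assms
    by (intro Lq_norm_cmult_le borel_measurable_times_ennreal weight_measurable) auto
  finally show ?thesis .
qed

lemma B_norm_le_cmult:
  assumes "b \<in> SV L" "0 < r" "g \<in> borel_measurable (lebesgue_on (ival L))"
    "g' \<in> borel_measurable (lebesgue_on (ival L))" "\<And>t. t \<in> ival L \<Longrightarrow> g t \<le> c * g' t"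
  shows "B_norm L p r b g \<le> c * B_norm L p r b g'"
  using B_norm_mono[OF assms(1,2,3,5), of p] B_norm_cmult_le[OF assms(1,2,4), of p c]
  by (rule order_trans)

lemma B_norm_max_le:
  assumes "b \<in> SV L" "0 < r" "g1 \<in> borel_measurable (lebesgue_on (ival L))"
    "g2 \<in> borel_measurable (lebesgue_on (ival L))"
  shows "B_norm L p r b (\<lambda>t. max (g1 t) (g2 t)) \<le>
    ennreal (2 powr recip r) * max (B_norm L p r b g1) (B_norm L p r b g2)"
proof -
  have *: "x * max y z = max (x * y) (x * z)" for x y z :: ennreal
    by (rule max_of_mono[symmetric]) (auto simp: mono_def intro: mult_left_mono)
  show ?thesis
    unfolding B_norm_def
    by (subst *, intro Lq_norm_max_le borel_measurable_times_ennreal weight_measurable) (use assms in auto)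
qed

lemma SV_near_0:
  assumes b: "b \<in> SV L" and L: "1 \<le> L" and \<epsilon>: "0 < \<epsilon>"
  obtains m M where "0 < m" "0 < M" "\<And>t. 0 < t \<Longrightarrow> t < 1 \<Longrightarrow> t powr \<epsilon> * b t \<le> M"
    "\<And>t. 0 < t \<Longrightarrow> t < 1/2 \<Longrightarrow> m \<le> t powr (- \<epsilon>) * b t"
proof -
  obtain C where C: "0 < C"
    "\<And>s t. t \<in> ival L \<Longrightarrow> 0 < s \<Longrightarrow> s \<le> t \<Longrightarrow> s powr \<epsilon> * b s \<le> C * (t powr \<epsilon> * b t)"
    "\<And>s t. t \<in> ival L \<Longrightarrow> 0 < s \<Longrightarrow> s \<le> t \<Longrightarrow> t powr (- \<epsilon>) * b t \<le> C * (s powr (- \<epsilon>) * b s)"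
    using SV_comparison[OF b \<epsilon>] by metis
  have I: "t \<in> ival L" if "0 < t" "t < 1" for t
    using unit_subset_ival[OF L] that by auto
  define z where "z = (1 / 2) powr (- \<epsilon>) * b (1 / 2)"
  have z: "0 < z" using SV_pos[OF b I[of "1/2"]] by (simp add: z_def)
  show ?thesis
  proof (rule that[of "z / C" "C * z"])
    show "0 < z / C" "0 < C * z" using C z by auto
    fix t :: real assume t: "0 < t"
    show "t powr \<epsilon> * b t \<le> C * z" if "t < 1"
    proof (cases "t \<le> 1 / 2")
      case True
      have "t powr \<epsilon> * b t \<le> C * ((1 / 2) powr \<epsilon> * b (1 / 2))"
        using C(2)[OF I[of "1/2"] t True] by simp
      also have "\<dots> \<le> C * z"
        unfolding z_def using C \<epsilon> SV_pos[OF b I[of "1/2"]]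
        by (intro mult_left_mono mult_right_mono powr_mono') auto
      finally show ?thesis .
    next
      case False
      have "t powr \<epsilon> * b t \<le> t powr (- \<epsilon>) * b t"
        using t that \<epsilon> SV_pos[OF b I[OF t that]] by (intro mult_right_mono powr_mono') auto
      also have "\<dots> \<le> C * z"
        unfolding z_def using C(3)[OF I[OF t that], of "1/2"] False by simp
      finally show ?thesis .
    qed
    show "z / C \<le> t powr (- \<epsilon>) * b t" if "t < 1 / 2"
      using C(3)[OF I[of "1/2"] t] that C(1) by (simp add: z_def field_simps)
  qed
qed

lemma indicator_lebesgue_on: "(\<lambda>t. ennreal (g t) * indicator {x<..<y} t) \<in> borel_measurable (lebesgue_on S)"
  if "g \<in> borel_measurable borel" for x y :: real
  by (intro lebesgue_on_borel borel_measurable_times_ennreal borel_measurable_indicator)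
    (use that in measurable)

text \<open>Half of the gap between \<open>e\<close> and 1/p bounds \<open>b\<close> near 0. The
  other half leaves \<open>t powr (\<epsilon> - recip r)\<close>, whose norm of exponent
  \<open>r\<close> over (0, 1) is finite.\<close>

lemma B_norm_powr_finite:
  assumes b: "b \<in> SV L" and L: "1 \<le> L" and r: "0 < r" and e: "e < recip p"
  shows "B_norm L p r b (\<lambda>t. ennreal (t powr (- e)) * indicator {0<..<1} t) < \<infinity>"
proof -
  define \<epsilon> where "\<epsilon> = (recip p - e) / 2"
  have \<epsilon>: "0 < \<epsilon>" using e by (simp add: \<epsilon>_def)
  obtain M where M: "0 < M" "\<And>t. 0 < t \<Longrightarrow> t < 1 \<Longrightarrow> t powr \<epsilon> * b t \<le> M"
    using SV_near_0[OF b L \<epsilon>] by metis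
  have bd: "t powr (recip p - recip r) * b t * t powr (- e) \<le> M * t powr (\<epsilon> - recip r)" if "0 < t" "t < 1" for t
  proof -
    have eq: "recip p - recip r + - e = \<epsilon> + (\<epsilon> - recip r)"
      by (simp add: \<epsilon>_def field_simps)
    have "t powr (recip p - recip r) * b t * t powr (- e) = t powr (recip p - recip r + - e) * b t"
      by (simp only: powr_add ac_simps)
    also have "\<dots> = (t powr \<epsilon> * b t) * t powr (\<epsilon> - recip r)"
      unfolding eq by (simp only: powr_add ac_simps)
    also have "\<dots> \<le> M * t powr (\<epsilon> - recip r)"
      using M(2)[OF that] by (intro mult_right_mono) auto
    finally show ?thesis .
  qed
  let ?h = "\<lambda>t. ennreal (M * t powr (\<epsilon> - recip r)) * indicator {0<..<1} t"
  have "B_norm L p r b (\<lambda>t. ennreal (t powr (- e)) * indicator {0<..<1} t) \<le> Lq_norm r (ival L) ?h"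
    unfolding B_norm_def
  proof (rule Lq_norm_mono[OF ival_lebesgue r])
    show "(\<lambda>t. ennreal (t powr (recip p - recip r) * b t) * (ennreal (t powr (- e)) * indicator {0<..<1} t))
        \<in> borel_measurable (lebesgue_on (ival L))"
      by (rule borel_measurable_times_ennreal[OF weight_measurable(2)[OF b] indicator_lebesgue_on]) measurable
    fix t assume t: "t \<in> ival L"
    show "ennreal (t powr (recip p - recip r) * b t) * (ennreal (t powr (- e)) * indicator {0<..<1} t) \<le> ?h t"
      using bd[of t] SV_pos[OF b t]
      by (auto simp: indicator_def simp flip: ennreal_mult intro!: ennreal_leI)
  qed
  also have "\<dots> < \<infinity>"
  proof (cases "r = \<infinity>")
    case True
    have "esssup (lebesgue_on (ival L)) (\<lambda>t. ennreal (M * t powr \<epsilon>) * indicator {0<..<1} t) \<le> ennreal M"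
    proof (intro esssup_I AE_I2 indicator_lebesgue_on)
      fix t :: real
      have "M * t powr \<epsilon> \<le> M * 1" if "0 < t" "t < 1"
        using that \<epsilon> M(1) powr_mono2[of \<epsilon> t 1] by (intro mult_left_mono) auto
      then show "ennreal (M * t powr \<epsilon>) * indicator {0<..<1} t \<le> ennreal M"
        by (auto simp: indicator_def intro!: ennreal_leI)
    qed measurable
    then show ?thesis
      using True by (auto simp: Lq_norm_def recip_top[simplified] less_top[symmetric] top_unique)
  next
    case False
    then obtain \<rho> where \<rho>: "r = ennreal \<rho>" "0 < \<rho>" using r by (cases r) auto
    have eq: "(\<epsilon> - 1 / \<rho>) * \<rho> = \<epsilon> * \<rho> - 1" using \<rho> by (simp add: field_simps)
    have "(\<integral>\<^sup>+t\<in>ival L. epow (ennreal (M * t powr (\<epsilon> - 1 / \<rho>)) * indicator {0<..<1} t) \<rho> \<partial>lebesgue)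
        \<le> (\<integral>\<^sup>+t. ennreal (M powr \<rho>) * (ennreal (t powr (\<epsilon> * \<rho> - 1)) * indicator {0<..<1} t) \<partial>lebesgue)"
      using M(1) eq by (intro nn_integral_mono)
        (auto simp: indicator_def epow_ennreal powr_mult powr_powr simp flip: ennreal_mult)
    also have "\<dots> = ennreal (M powr \<rho>) * (\<integral>\<^sup>+t\<in>{0<..<1}. ennreal (t powr (\<epsilon> * \<rho> - 1)) \<partial>lebesgue)"
      by (intro nn_integral_cmult borel_imp_lebesgue_measurable) measurable
    also have "\<dots> < top"
      using nn_integral_powr_from_0[of "\<epsilon> * \<rho>" 1] \<epsilon> \<rho> by (simp add: ennreal_mult_less_top)
    finally show ?thesis
      using \<rho> by (simp add: Lq_norm_ennreal recip_ennreal less_top[symmetric])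
  qed
  finally show ?thesis .
qed

lemma B_norm_unit_pos:
  assumes b: "b \<in> SV L" and L: "1 \<le> L" and r: "0 < r"
  shows "B_norm L p r b (indicator {0<..<1}) \<noteq> 0"
proof
  let ?h = "\<lambda>t. ennreal (t powr (recip p - recip r) * b t) * indicator {0<..<1} t"
  assume "B_norm L p r b (indicator {0<..<1}) = 0"
  then have "AE t in lebesgue_on (ival L). ?h t = 0"
    unfolding B_norm_def
    by (intro Lq_norm_eq_0_imp_AE[OF r] borel_measurable_times_ennreal weight_measurable b
        lebesgue_on_borel) auto
  then have "AE t in lebesgue. t \<in> ival L \<longrightarrow> ?h t = 0"
    by (simp add: AE_restrict_space_iff)
  from AE_lebesgue_Ioo_ex[OF this zero_less_one]
  obtain t :: real where t: "0 < t" "t < 1" "t \<in> ival L \<longrightarrow> ?h t = 0"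
    by blast
  then show False
    using unit_subset_ival[OF L] SV_pos[OF b, of t] by (auto simp: ennreal_eq_0_iff mult_le_0_iff)
qed

text \<open>The space contains an \<open>f\<close> that is not zero almost everywhere, and its
  rearrangement stays above some l > 0 on an interval (0, \<tau>); this controls the norm near 0. On
  the rest of (0, 1) the constant 1 is at most a multiple of a power with exponent admissible in
  \<open>B_norm_powr_finite\<close>.\<close>

lemma B_norm_unit_finite:
  assumes b: "b \<in> SV L" and L: "1 \<le> L" and r: "0 < r"
    and nontriv: "nontrivial_space L (LK_space L p r b)"
  shows "B_norm L p r b (indicator {0<..<1}) < \<infinity>"
proof -
  obtain f where f: "f \<in> meas_fun L" "LK_norm L p r b f < \<infinity>" "\<not> (AE x in lebesgue_on (ival L). f x = 0)"
    using nontriv by (auto simp: nontrivial_space_def LK_space_def)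
  have "\<exists>n. emeasure lebesgue {x \<in> ival L. 1 / real (Suc n) < cmod (f x)} \<noteq> 0"
  proof (rule ccontr)
    assume "\<not> ?thesis"
    then have "{x \<in> ival L. 1 / real (Suc n) < cmod (f x)} \<in> null_sets lebesgue" for n
      using level_set_lebesgue[OF f(1)] by auto
    then have "AE x in lebesgue. \<forall>n. x \<notin> {x \<in> ival L. 1 / real (Suc n) < cmod (f x)}"
      by (simp only: AE_all_countable) (blast intro: AE_not_in)
    then have "AE x in lebesgue. x \<in> ival L \<longrightarrow> f x = 0"
    proof eventually_elim
      case (elim x)
      show ?case
      proof (intro impI, rule ccontr)
        assume x: "x \<in> ival L" "f x \<noteq> 0"
        then obtain n where "1 / real (Suc n) < cmod (f x)"
          using nat_approx_posE[of "cmod (f x)"] by auto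
        then show False using elim x by blast
      qed
    qed
    then show False using f(3) by (simp add: AE_restrict_space_iff)
  qed
  then obtain l where l: "0 < l" "emeasure lebesgue {x \<in> ival L. l < cmod (f x)} \<noteq> 0"
    by (metis of_nat_0_less_iff zero_less_Suc zero_less_divide_1_iff)
  define \<mu> where "\<mu> = emeasure lebesgue {x \<in> ival L. l < cmod (f x)}"
  \<comment> \<open>The level set may have infinite measure; the minimum with 1 gives a real \<tau>
    that is also less than 1.\<close>
  have "0 < min 1 \<mu>" using l by (simp add: \<mu>_def zero_less_iff_neq_zero)
  then obtain z where z: "0 < z" "z < min 1 \<mu>"
    using dense by blast
  moreover from z have "z \<noteq> top" by auto
  ultimately obtain \<tau> where \<tau>: "0 < \<tau>" "ennreal \<tau> < min 1 \<mu>"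
    by (cases z) auto
  have \<tau>1: "\<tau> < 1" using \<tau> by (simp add: ennreal_less_one_iff)
  have ge: "ennreal l \<le> rearr L f t" if "t < \<tau>" for t
  proof -
    have "ennreal l \<le> rearr L f \<tau>"
      by (rule rearr_ge[OF f(1)]) (use \<tau> in \<open>simp add: \<mu>_def\<close>)
    also have "\<dots> \<le> rearr L f t"
      using rearr_antimono[of L f] that by (simp add: antimono_def)
    finally show ?thesis .
  qed
  \<comment> \<open>Any exponent below 1/p would do. As \<open>e\<close> can have either sign,
    \<open>d\<close> uses its absolute value to be a lower bound for \<open>t powr (- e)\<close> on
    [\<tau>, 1).\<close>
  define e where "e = recip p - 1"
  define d where "d = \<tau> powr \<bar>e\<bar>"
  have d: "0 < d" using \<tau> by (simp add: d_def)
  have small: "1 \<le> ennreal (1 / d) * ennreal (t powr (- e))" if "\<tau> \<le> t" "t < 1" for t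
  proof -
    have "d \<le> t powr (- e)"
    proof (cases "0 \<le> e")
      case True
      have "d \<le> 1" using \<tau> \<tau>1 powr_mono2[of "\<bar>e\<bar>" \<tau> 1] by (simp add: d_def)
      also have "1 \<le> t powr (- e)" using True that \<tau> powr_mono2'[of "- e" t 1] by simp
      finally show ?thesis .
    next
      case False
      then show ?thesis using that \<tau> by (simp add: d_def powr_mono2)
    qed
    then show ?thesis using d by (simp flip: ennreal_mult)
  qed
  have m: "(indicator {0<..<\<tau>} :: real \<Rightarrow> ennreal) \<in> borel_measurable (lebesgue_on (ival L))"
    by (intro lebesgue_on_borel) measurable
  have m1: "(indicator {0<..<1} :: real \<Rightarrow> ennreal) \<in> borel_measurable (lebesgue_on (ival L))"
    by (intro lebesgue_on_borel) measurable
  have m2: "(\<lambda>t. ennreal (t powr (- e)) * indicator {0<..<1} t) \<in> borel_measurable (lebesgue_on (ival L))"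
    by (intro indicator_lebesgue_on) measurable
  have m3: "(\<lambda>t. ennreal (1 / d) * (ennreal (t powr (- e)) * indicator {0<..<1} t)) \<in> borel_measurable (lebesgue_on (ival L))"
    using m2 by measurable
  have "B_norm L p r b (indicator {0<..<\<tau>}) \<le> ennreal (1 / l) * B_norm L p r b (rearr L f)"
  proof (rule B_norm_le_cmult[OF b r m])
    show "rearr L f \<in> borel_measurable (lebesgue_on (ival L))"
      by (intro lebesgue_on_borel borel_measurable_antimono_ennreal rearr_antimono)
    fix t
    have "1 \<le> ennreal (1 / l) * rearr L f t" if "t < \<tau>"
      using mult_left_mono[OF ge[OF that], of "ennreal (1 / l)"] l(1) by (simp flip: ennreal_mult)
    then show "indicator {0<..<\<tau>} t \<le> ennreal (1 / l) * rearr L f t"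
      by (auto simp: indicator_def)
  qed
  also have "\<dots> < \<infinity>"
    using f(2) by (simp add: LK_norm_def ennreal_mult_eq_top_iff less_top[symmetric])
  finally have fin1: "B_norm L p r b (indicator {0<..<\<tau>}) < \<infinity>" .
  have "B_norm L p r b (\<lambda>t. ennreal (1 / d) * (ennreal (t powr (- e)) * indicator {0<..<1} t))
      \<le> ennreal (1 / d) * B_norm L p r b (\<lambda>t. ennreal (t powr (- e)) * indicator {0<..<1} t)"
    by (rule B_norm_cmult_le[OF b r m2])
  also have "\<dots> < \<infinity>"
    using B_norm_powr_finite[OF b L r, of e p] by (simp add: e_def ennreal_mult_eq_top_iff less_top[symmetric])
  finally have fin2: "B_norm L p r b (\<lambda>t. ennreal (1 / d) * (ennreal (t powr (- e)) * indicator {0<..<1} t)) < \<infinity>" .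
  have "B_norm L p r b (indicator {0<..<1}) \<le> B_norm L p r b
      (\<lambda>t. max (indicator {0<..<\<tau>} t) (ennreal (1 / d) * (ennreal (t powr (- e)) * indicator {0<..<1} t)))"
  proof (rule B_norm_mono[OF b r m1])
    fix t :: real
    show "indicator {0<..<1} t \<le> max (indicator {0<..<\<tau>} t) (ennreal (1 / d) * (ennreal (t powr (- e)) * indicator {0<..<1} t))"
      using small[of t] by (cases "t < \<tau>") (auto simp: indicator_def le_max_iff_disj)
  qed
  also have "\<dots> \<le> ennreal (2 powr recip r) * max (B_norm L p r b (indicator {0<..<\<tau>}))
      (B_norm L p r b (\<lambda>t. ennreal (1 / d) * (ennreal (t powr (- e)) * indicator {0<..<1} t)))"
    by (rule B_norm_max_le[OF b r m m3])
  also have "\<dots> < \<infinity>"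
    using fin1 fin2 by (simp add: ennreal_mult_eq_top_iff max_def less_top[symmetric])
  finally show ?thesis .
qed

lemma Lq_norm_const:
  assumes "0 < q" "0 < s" "0 \<le> k"
  shows "Lq_norm q {s<..<2 * s} (\<lambda>_. ennreal k) = ennreal (k * s powr recip q)"
proof (cases "q = \<infinity>")
  case True
  have "emeasure (lebesgue_on {s<..<2 * s}) (space (lebesgue_on {s<..<2 * s})) \<noteq> 0"
    using assms by (simp add: emeasure_restrict_space)
  then show ?thesis
    using True assms by (simp add: Lq_norm_def recip_top[simplified] esssup_const)
next
  case False
  then obtain \<rho> where \<rho>: "q = ennreal \<rho>" "0 < \<rho>" using assms(1) by (cases q) auto
  have "(\<integral>\<^sup>+x\<in>{s<..<2 * s}. epow (ennreal k) \<rho> \<partial>lebesgue) = ennreal (k powr \<rho> * s)"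
    using assms by (subst nn_integral_cmult_indicator) (auto simp: epow_ennreal simp flip: ennreal_mult)
  then show ?thesis
    using \<rho> assms by (simp add: Lq_norm_ennreal recip_ennreal epow_ennreal powr_mult powr_powr)
qed

text \<open>The interval (s, 2s) alone suffices: function, weight and length together contribute
  about \<open>s powr (recip p - a) * b s\<close>, and the exponent is negative. Half of it, \<eta>,
  is spent on the lower bound for \<open>b\<close>; the other half tends to infinity as
  \<open>s\<close> decreases.\<close>

lemma B_norm_cut_powr_unbounded:
  assumes b: "b \<in> SV L" and L: "1 \<le> L" and r: "0 < r" and a: "recip p < a" and \<tau>: "0 < \<tau>" "\<tau> < 1"
  obtains s where "0 < s" "s < \<tau>"
    "ennreal M \<le> B_norm L p r b (\<lambda>t. ennreal (cut_powr s a t) * indicator {0<..<\<tau>} t)"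
proof -
  define \<eta> where "\<eta> = (a - recip p) / 2"
  have \<eta>: "0 < \<eta>" using a by (simp add: \<eta>_def)
  obtain m where m: "0 < m" "\<And>t. 0 < t \<Longrightarrow> t < 1/2 \<Longrightarrow> m \<le> t powr (- \<eta>) * b t"
    using SV_near_0[OF b L \<eta>] by metis
  define R where "R = recip r"
  define P where "P = recip p"
  have R: "0 \<le> R" by (simp add: R_def recip_nonneg)
  \<comment> \<open>\<open>Y\<close> is the size that \<open>x powr (- \<eta>)\<close> must reach
    for the norm to exceed \<open>M\<close>; the factor \<open>2 powr R\<close> compensates s = x/2
    in the length of the interval.\<close>
  define Y where "Y = max 1 (M * 2 powr R / m)"
  have Y: "1 \<le> Y" "M * 2 powr R / m \<le> Y" by (auto simp: Y_def)
  define x where "x = min (\<tau> / 2) (Y powr (- (1 / \<eta>)))"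
  have x: "0 < x" "x < 1/2" "x < \<tau>" using \<tau> Y by (auto simp: x_def)
  have xY: "Y \<le> x powr (- \<eta>)"
  proof -
    have "Y = (Y powr (- (1 / \<eta>))) powr (- \<eta>)"
      using \<eta> Y by (simp add: powr_powr)
    also have "\<dots> \<le> x powr (- \<eta>)"
      using x \<eta> by (intro powr_mono2') (auto simp: x_def)
    finally show ?thesis .
  qed
  define s where "s = x / 2"
  have s: "0 < s" "s < \<tau>" "2 * s = x" using x by (auto simp: s_def)
  let ?h = "\<lambda>t. ennreal (t powr (P - R) * b t) * (ennreal (cut_powr s a t) * indicator {0<..<\<tau>} t)"
  have hm: "?h \<in> borel_measurable (lebesgue_on (ival L))"
    by (intro borel_measurable_times_ennreal[OF weight_measurable(2)[OF b] indicator_lebesgue_on] cut_powr_measurable)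
  have sub: "{s<..<2 * s} \<subseteq> ival L"
    using unit_subset_ival[OF L] s x by auto
  define k where "k = m * x powr (- R) * x powr (- \<eta>)"
  have k: "0 \<le> k" using m by (simp add: k_def)
  have "M \<le> m * (Y / 2 powr R)"
    using Y(2) m by (simp add: field_simps)
  also have "\<dots> \<le> m * (x powr (- \<eta>) / 2 powr R)"
    using xY m by (intro mult_left_mono divide_right_mono) auto
  also have "\<dots> = m * x powr (- \<eta>) * (x powr (- R) * x powr R) / 2 powr R"
    using x by (simp flip: powr_add)
  also have "\<dots> = k * s powr R"
    using x by (simp add: k_def s_def powr_divide)
  finally have "ennreal M \<le> ennreal (k * s powr R)"
    by (rule ennreal_leI)
  also have "\<dots> = Lq_norm r {s<..<2 * s} (\<lambda>_. ennreal k)"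
    unfolding R_def by (rule Lq_norm_const[symmetric]) (use r s k in auto)
  also have "\<dots> \<le> Lq_norm r {s<..<2 * s} ?h"
  proof (rule Lq_norm_mono)
    fix t assume t: "t \<in> {s<..<2 * s}"
    have t': "0 < t" "t < x" "s < t" "t < 1/2" using t s x by auto
    have bt: "0 < b t" using SV_pos[OF b] sub t by auto
    have "k \<le> (t powr (- \<eta>) * b t) * t powr (- R) * t powr (- \<eta>)"
      unfolding k_def using m(2)[OF t'(1,4)] t' R \<eta> m(1) bt
      by (intro mult_mono[of _ "_ * _"] mult_mono[of m] powr_mono2') auto
    also have "\<dots> = t powr (- \<eta> + - R + - \<eta>) * b t"
      by (simp only: powr_add ac_simps)
    also have "- \<eta> + - R + - \<eta> = (P - R) + - a"
      by (simp add: \<eta>_def P_def field_simps)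
    also have "t powr ((P - R) + - a) * b t = t powr (P - R) * b t * cut_powr s a t"
      unfolding powr_add using t' by (simp add: cut_powr_def ac_simps)
    finally show "ennreal k \<le> ?h t"
      using t' x bt by (auto simp: indicator_def cut_powr_nonneg simp flip: ennreal_mult intro!: ennreal_leI)
  qed (use r in auto)
  also have "\<dots> \<le> Lq_norm r (ival L) ?h"
    by (rule Lq_norm_subset[OF _ _ sub r hm]) auto
  finally have "ennreal M \<le> B_norm L p r b (\<lambda>t. ennreal (cut_powr s a t) * indicator {0<..<\<tau>} t)"
    by (simp add: B_norm_def P_def R_def)
  then show ?thesis using that s by blast
qed

section \<open>The equivalences\<close>

lemma avg_upper_cut_powr:
  assumes "0 < \<omega>" "0 \<le> a" "a < u" "t \<in> ival L" "t < 1"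
  shows "avg u \<omega> {0<..<t} (rearr L (\<lambda>x. complex_of_real (cut_powr 0 a x))) t =
    ennreal ((1 / ((u - a) * \<omega>)) powr (1 / \<omega>)) * ennreal (cut_powr 0 a t)"
proof -
  let ?F = "rearr L (\<lambda>x. complex_of_real (cut_powr 0 a x))"
  have t: "0 < t" using ival_pos[OF assms(4)] .
  have eq: "?F v = ennreal (v powr (- a)) * 1" if "0 < v" "v < t" for v
    using rearr_cut_powr[OF assms(2) ival_down[OF assms(4) that(1)]] that assms(5)
    by (simp add: cut_powr_def max_def)
  have "avg u \<omega> {0<..<t} ?F t = avg u \<omega> {0<..<t} (\<lambda>v. ennreal (v powr (- a)) * 1) t"
    by (intro antisym avg_mono) (use eq assms(1) in auto)
  also have "\<dots> = ennreal ((1 / ((u - a) * \<omega>)) powr (1 / \<omega>)) * ennreal (t powr (- a))"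
    using assms t by (subst avg_upper_powr) (auto simp: ennreal_mult)
  finally show ?thesis
    using t assms(5) by (simp add: cut_powr_def max_def)
qed

text \<open>The end of both counterexamples. Finiteness is essential, since infinity satisfies the
  first inequality as well.\<close>

lemma ennreal_le_half_imp:
  fixes x :: ennreal
  assumes "x \<le> ennreal (1 / 2) * x" "x < \<infinity>"
  shows "x = 0"
proof -
  obtain \<xi> where \<xi>: "x = ennreal \<xi>" "0 \<le> \<xi>" using assms(2) by (cases x) auto
  have "ennreal \<xi> \<le> ennreal (1 / 2 * \<xi>)"
    using assms(1) \<xi> by (subst ennreal_mult) auto
  then have "\<xi> \<le> 1 / 2 * \<xi>"
    using \<xi>(2) by (subst (asm) ennreal_le_iff) auto
  then show ?thesis using \<xi> by simp
qed

text \<open>The exponent a = u - \<delta> lies strictly below 1/p even if u = 1/p, so the test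
  function has finite norm \<open>N\<close>. Its average exceeds it pointwise on (0, 1) by a factor
  of at least 2/c, so the assumed inequality gives \<open>N \<le> N / 2\<close>.\<close>

lemma not_avg_upper_le:
  assumes b: "b \<in> SV L" and L: "1 \<le> L" and r: "0 < r" and \<omega>: "0 < \<omega>" and u: "0 < u" "u \<le> recip p"
    and c: "0 < c"
    and le: "\<And>f. f \<in> meas_fun L \<Longrightarrow> ennreal c * B_norm L p r b (\<lambda>t. avg u \<omega> {0<..<t} (rearr L f) t)
      \<le> B_norm L p r b (rearr L f)"
  shows False
proof -
  \<comment> \<open>The second entry solves
    \<open>(1 / (\<delta> * \<omega>)) powr (1 / \<omega>) = 2 / c\<close>; the first keeps the
    exponent \<open>a\<close> positive, so that the test function is non-increasing.\<close>
  define \<delta> where "\<delta> = min (u / 2) (1 / (\<omega> * (2 / c) powr \<omega>))"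
  have \<delta>: "0 < \<delta>" "\<delta> < u" using u \<omega> c by (auto simp: \<delta>_def)
  define K where "K = (1 / (\<delta> * \<omega>)) powr (1 / \<omega>)"
  have K: "2 / c \<le> K"
  proof -
    have "\<delta> * (\<omega> * (2 / c) powr \<omega>) \<le> 1 / (\<omega> * (2 / c) powr \<omega>) * (\<omega> * (2 / c) powr \<omega>)"
      using \<omega> c by (intro mult_right_mono) (auto simp: \<delta>_def)
    then have "(2 / c) powr \<omega> \<le> 1 / (\<delta> * \<omega>)"
      using \<delta> \<omega> c by (simp add: field_simps)
    then have "((2 / c) powr \<omega>) powr (1 / \<omega>) \<le> K"
      unfolding K_def using \<omega> by (intro powr_mono2) auto
    then show ?thesis using \<omega> c by (simp add: powr_powr)
  qed
  then have K0: "0 < K" using c by (meson divide_pos_pos less_le_trans zero_less_numeral)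
  define a where "a = u - \<delta>"
  have a: "0 \<le> a" "a < u" "a < recip p" using \<delta> u by (auto simp: a_def)
  define f where "f = (\<lambda>x. complex_of_real (cut_powr 0 a x))"
  have f: "f \<in> meas_fun L" unfolding f_def by (rule cut_powr_meas_fun)
  have rf: "rearr L f t = ennreal (cut_powr 0 a t)" if "t \<in> ival L" for t
    unfolding f_def by (rule rearr_cut_powr[OF a(1) that])
  have rm: "rearr L f \<in> borel_measurable (lebesgue_on (ival L))"
    by (intro lebesgue_on_borel borel_measurable_antimono_ennreal rearr_antimono)
  define G where "G = B_norm L p r b (\<lambda>t. avg u \<omega> {0<..<t} (rearr L f) t)"
  define N where "N = B_norm L p r b (rearr L f)"
  have "N \<le> ennreal (1 / K) * G"
    unfolding N_def G_def
  proof (rule B_norm_le_cmult[OF b r rm lebesgue_on_borel[OF avg_upper_measurable[OF \<omega>]]])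
    fix t assume t: "t \<in> ival L"
    show "rearr L f t \<le> ennreal (1 / K) * avg u \<omega> {0<..<t} (rearr L f) t"
    proof (cases "t < 1")
      case True
      have "avg u \<omega> {0<..<t} (rearr L f) t = ennreal K * ennreal (cut_powr 0 a t)"
        unfolding f_def K_def using avg_upper_cut_powr[OF \<omega> a(1,2) t True] by (simp add: a_def)
      then have "ennreal (1 / K) * avg u \<omega> {0<..<t} (rearr L f) t = ennreal (cut_powr 0 a t)"
        using K0 by (simp add: mult.assoc[symmetric] flip: ennreal_mult)
      then show ?thesis using rf[OF t] by simp
    qed (simp add: rf[OF t] cut_powr_def)
  qed
  also have "G = ennreal (1 / c) * (ennreal c * G)"
    using c by (simp add: mult.assoc[symmetric] flip: ennreal_mult)
  also have "ennreal (1 / K) * \<dots> \<le> ennreal (1 / K) * (ennreal (1 / c) * N)"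
    unfolding N_def G_def using le[OF f] by (intro mult_left_mono) auto
  also have "\<dots> = ennreal (1 / K * (1 / c)) * N"
    unfolding mult.assoc[symmetric] using K0 c by (subst ennreal_mult) auto
  also have "\<dots> \<le> ennreal (1 / 2) * N"
    using K K0 c by (intro mult_right_mono ennreal_leI) (auto simp: field_simps)
  finally have half: "N \<le> ennreal (1 / 2) * N" .
  have "N \<le> B_norm L p r b (\<lambda>t. ennreal (t powr (- a)) * indicator {0<..<1} t)"
    unfolding N_def
  proof (rule B_norm_mono[OF b r rm])
    fix t assume t: "t \<in> ival L"
    show "rearr L f t \<le> ennreal (t powr (- a)) * indicator {0<..<1} t"
      using rf[OF t] ival_pos[OF t] by (auto simp: cut_powr_def indicator_def max_def)
  qed
  also have "\<dots> < \<infinity>"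
    by (rule B_norm_powr_finite[OF b L r a(3)])
  finally have "N = 0"
    using half by (intro ennreal_le_half_imp)
  \<comment> \<open>\<open>N\<close> is not zero because the test function is at least 1 on (0,
    1).\<close>
  moreover have "B_norm L p r b (indicator {0<..<1}) \<le> N"
    unfolding N_def
  proof (rule B_norm_mono[OF b r])
    fix t assume t: "t \<in> ival L"
    show "indicator {0<..<1} t \<le> rearr L f t"
      using rf[OF t] a(1) powr_mono2'[of "- a" t 1] by (auto simp: cut_powr_def indicator_def max_def)
  qed (intro lebesgue_on_borel, measurable)
  ultimately show False
    using B_norm_unit_pos[OF b L r, of p] by simp
qed

text \<open>Only the integral over (y, 1) is kept, where the function is the pure power. With d =
  \<delta> \<omega> it equals \<open>(y powr (- d) - 1) / d\<close>. The truncation at 1 causes the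
  subtracted 1, and the third condition on \<open>y\<close> makes it at most half of
  \<open>y powr (- d)\<close>; this is the 2 in the constant.\<close>

lemma avg_lower_cut_powr_ge:
  assumes \<omega>: "0 < \<omega>" and "0 \<le> u" "0 < \<delta>" "0 \<le> s" "1 \<le> L" and t: "t \<in> ival L"
    and y: "y = max s t" "y < 1" "y powr (\<delta> * \<omega>) \<le> 1 / 2"
  shows "ennreal ((1 / (2 * (\<delta> * \<omega>))) powr (1 / \<omega>)) * ennreal (cut_powr s (u + \<delta>) t) \<le>
    avg u \<omega> (ival L \<inter> {t<..}) (rearr L (\<lambda>x. complex_of_real (cut_powr s (u + \<delta>) x))) t"
proof -
  let ?F = "rearr L (\<lambda>x. complex_of_real (cut_powr s (u + \<delta>) x))"
  define d where "d = \<delta> * \<omega>"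
  have d: "0 < d" using assms by (simp add: d_def)
  have t0: "0 < t" using ival_pos[OF t] .
  have y0: "0 < y" "t \<le> y" "s \<le> y" using t0 y(1) by auto
  have "1 / (2 * d) * y powr (- d) = (y powr (- d) - y powr (- d) / 2) / d"
    using d by (simp add: field_simps)
  also have "\<dots> \<le> (y powr (- d) - 1) / d"
  proof -
    have "2 \<le> y powr (- d)"
      using y(3) y0 by (simp add: powr_minus_divide d_def field_simps)
    then show ?thesis using d by (intro divide_right_mono) auto
  qed
  finally have *: "1 / (2 * d) * y powr (- d) \<le> (1 powr (- d) - y powr (- d)) / (- d)"
    using d by (simp add: minus_divide_right[symmetric] minus_divide_left)
  have "(1 / (2 * d)) powr (1 / \<omega>) * y powr (- (u + \<delta>)) = y powr (- u) * (1 / (2 * d) * y powr (- d)) powr (1 / \<omega>)"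
  proof -
    have "(1 / (2 * d) * y powr (- d)) powr (1 / \<omega>) = (1 / (2 * d)) powr (1 / \<omega>) * y powr (- \<delta>)"
      using d \<omega> by (subst powr_mult) (auto simp: powr_powr d_def)
    moreover have "y powr (- (u + \<delta>)) = y powr (- u) * y powr (- \<delta>)"
      by (simp flip: powr_add)
    ultimately show ?thesis by simp
  qed
  \<comment> \<open>Since t is at most y, passing from \<open>y powr (- u)\<close> to the outer
    factor \<open>t powr (- u)\<close> of the average only increases the value.\<close>
  also have "\<dots> \<le> t powr (- u) * ((1 powr (- d) - y powr (- d)) / (- d)) powr (1 / \<omega>)"
    using * y0 t0 d \<omega> \<open>0 \<le> u\<close> by (intro mult_mono powr_mono2 powr_mono2') auto
  finally have "ennreal ((1 / (2 * d)) powr (1 / \<omega>) * y powr (- (u + \<delta>)))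
      \<le> ennreal (t powr (- u) * ((1 powr (- d) - y powr (- d)) / (- d)) powr (1 / \<omega>))"
    by (rule ennreal_leI)
  also have "\<dots> = ennreal (t powr (- u)) * epow (ennreal ((1 powr (- d) - y powr (- d)) / (- d))) (1 / \<omega>)"
  proof -
    have "0 \<le> 1 / (2 * d) * y powr (- d)" using d by simp
    with * have "0 \<le> (1 powr (- d) - y powr (- d)) / (- d)" by linarith
    then show ?thesis by (simp only: epow_ennreal) (simp add: ennreal_mult)
  qed
  also have "\<dots> = ennreal (t powr (- u)) * epow (\<integral>\<^sup>+v\<in>{y<..<1}. ennreal (v powr (- d - 1)) \<partial>lebesgue) (1 / \<omega>) * 1"
    using d y0 y by (subst nn_integral_powr_Ioo) auto
  also have "\<dots> = avg u \<omega> {y<..<1} (\<lambda>v. ennreal (v powr (- (u + \<delta>))) * 1) t"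
    using y0 \<omega> by (subst avg_powr) (auto simp: d_def)
  also have "\<dots> \<le> avg u \<omega> (ival L \<inter> {t<..}) ?F t"
  proof (intro avg_mono AE_I2 impI \<omega>)
    show sub: "{y<..<1} \<subseteq> ival L \<inter> {t<..}"
      using unit_subset_ival[OF \<open>1 \<le> L\<close>] y0 by auto
    fix v assume v: "v \<in> {y<..<1}"
    then have "?F v = ennreal (cut_powr s (u + \<delta>) v)"
      using sub assms by (intro rearr_cut_powr) auto
    then show "ennreal (v powr (- (u + \<delta>))) * 1 \<le> ?F v"
      using v y0 by (simp add: cut_powr_def max_def)
  qed auto
  also have "(1 / (2 * d)) powr (1 / \<omega>) * y powr (- (u + \<delta>))
      = (1 / (2 * (\<delta> * \<omega>))) powr (1 / \<omega>) * cut_powr s (u + \<delta>) t"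
    using y y0 by (simp add: cut_powr_def d_def)
  finally show ?thesis
    by (simp add: ennreal_mult cut_powr_nonneg)
qed

text \<open>Now a = u + \<delta> exceeds 1/p, so it is the cut at s > 0 that makes the norm finite.
  The amplification by \<open>K\<close> is available only on (0, \<tau>), because the test function
  vanishes from 1 on. Beyond \<tau> the function is at most \<open>\<tau> powr (- a)\<close>, and
  \<open>s\<close> is taken so small that this part is dominated by the norm \<open>B1\<close> of
  the part on (0, \<tau>). The assumed inequality then reads \<open>B1 \<le> B1 / 2\<close>.\<close>

lemma not_avg_lower_le:
  assumes b: "b \<in> SV L" and L: "1 \<le> L" and r: "0 < r" and \<omega>: "0 < \<omega>" and u: "recip p \<le> u"
    and nontriv: "nontrivial_space L (LK_space L p r b)" and c: "0 < c"
    and le: "\<And>f. f \<in> meas_fun L \<Longrightarrow>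
      ennreal c * B_norm L p r b (\<lambda>t. avg u \<omega> (ival L \<inter> {t<..}) (rearr L f) t) \<le> B_norm L p r b (rearr L f)"
  shows False
proof -
  have u0: "0 \<le> u" using u recip_nonneg[of p] by simp
  define D where "D = 2 powr recip r"
  have D: "0 < D" by (simp add: D_def)
  \<comment> \<open>Cancels the constant \<open>c\<close> of the assumed inequality and the
    quasi-norm constant \<open>D\<close> from splitting at \<tau>, with a factor 2 to spare.\<close>
  define K where "K = 2 * D / c"
  have K: "0 < K" using D c by (simp add: K_def)
  \<comment> \<open>Solves the equation that makes the constant in
    \<open>avg_lower_cut_powr_ge\<close> equal to \<open>K\<close>.\<close>
  define \<delta> where "\<delta> = 1 / (2 * \<omega> * K powr \<omega>)"
  have \<delta>: "0 < \<delta>" using \<omega> K by (simp add: \<delta>_def)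
  have K_eq: "(1 / (2 * (\<delta> * \<omega>))) powr (1 / \<omega>) = K"
  proof -
    have "1 / (2 * (\<delta> * \<omega>)) = K powr \<omega>"
      using \<omega> K by (simp add: \<delta>_def field_simps)
    then show ?thesis using \<omega> K by (simp add: powr_powr)
  qed
  define a where "a = u + \<delta>"
  have a: "0 \<le> a" "recip p < a" using u0 \<delta> u by (auto simp: a_def)
  \<comment> \<open>The largest \<tau> for which the condition of
    \<open>avg_lower_cut_powr_ge\<close> holds up to \<tau>. It depends on \<delta> and \<omega>
    only, so \<open>s\<close> can be chosen afterwards.\<close>
  define \<tau> where "\<tau> = (1 / 2 :: real) powr (1 / (\<delta> * \<omega>))"
  have \<tau>: "0 < \<tau>" "\<tau> < 1" "\<tau> powr (\<delta> * \<omega>) = 1 / 2"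
  proof -
    show "0 < \<tau>" by (simp add: \<tau>_def)
    show "\<tau> < 1" using \<delta> \<omega> powr_less_mono2[of "1 / (\<delta> * \<omega>)" "1/2" 1] by (simp add: \<tau>_def)
    show "\<tau> powr (\<delta> * \<omega>) = 1 / 2" using \<delta> \<omega> by (simp add: \<tau>_def powr_powr)
  qed
  define N where "N = B_norm L p r b (indicator {0<..<1})"
  have N: "N < \<infinity>" "N \<noteq> 0"
    unfolding N_def by (rule B_norm_unit_finite[OF b L r nontriv], rule B_norm_unit_pos[OF b L r])
  have "ennreal (\<tau> powr (- a)) * N < top"
    using N by (simp add: ennreal_mult_less_top)
  \<comment> \<open>A real \<open>M\<close> exists because the norm of the indicator is finite, by
    nontriviality of the space; it bounds the part of the test function beyond \<tau> for every
    choice of \<open>s\<close>.\<close>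
  then obtain M where M: "ennreal (\<tau> powr (- a)) * N = ennreal M"
    by (cases "ennreal (\<tau> powr (- a)) * N") auto
  obtain s where s: "0 < s" "s < \<tau>"
    "ennreal M \<le> B_norm L p r b (\<lambda>t. ennreal (cut_powr s a t) * indicator {0<..<\<tau>} t)"
    using B_norm_cut_powr_unbounded[OF b L r a(2) \<tau>(1,2)] by blast
  let ?g = "\<lambda>t. ennreal (cut_powr s a t) * indicator {0<..<\<tau>} t"
  define B1 where "B1 = B_norm L p r b ?g"
  define f where "f = (\<lambda>x. complex_of_real (cut_powr s a x))"
  have f: "f \<in> meas_fun L" unfolding f_def by (rule cut_powr_meas_fun)
  have rf: "rearr L f t = ennreal (cut_powr s a t)" if "t \<in> ival L" for t
    unfolding f_def by (rule rearr_cut_powr[OF a(1) that])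
  have rm: "rearr L f \<in> borel_measurable (lebesgue_on (ival L))"
    by (intro lebesgue_on_borel borel_measurable_antimono_ennreal rearr_antimono)
  have gm: "?g \<in> borel_measurable (lebesgue_on (ival L))"
    by (intro indicator_lebesgue_on cut_powr_measurable)
  have im: "(indicator {0<..<1} :: real \<Rightarrow> ennreal) \<in> borel_measurable (lebesgue_on (ival L))"
    by (intro lebesgue_on_borel) measurable
  have im\<tau>: "(\<lambda>t. ennreal (\<tau> powr (- a)) * indicator {0<..<1} t) \<in> borel_measurable (lebesgue_on (ival L))"
    by (intro borel_measurable_times_ennreal im) simp
  define G where "G = B_norm L p r b (\<lambda>t. avg u \<omega> (ival L \<inter> {t<..}) (rearr L f) t)"
  have "B1 \<le> ennreal (1 / K) * G"
    unfolding B1_def G_def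
  proof (rule B_norm_le_cmult[OF b r gm lebesgue_on_borel[OF avg_lower_measurable[OF \<omega>]]])
    fix t assume t: "t \<in> ival L"
    show "?g t \<le> ennreal (1 / K) * avg u \<omega> (ival L \<inter> {t<..}) (rearr L f) t"
    proof (cases "t < \<tau>")
      case True
      have "max s t powr (\<delta> * \<omega>) \<le> \<tau> powr (\<delta> * \<omega>)"
        using True s \<delta> \<omega> by (intro powr_mono2) auto
      then have "ennreal K * ennreal (cut_powr s a t) \<le> avg u \<omega> (ival L \<inter> {t<..}) (rearr L f) t"
        using avg_lower_cut_powr_ge[OF \<omega> u0 \<delta> _ L t refl, of s] s True \<tau>
        unfolding K_eq a_def[symmetric] f_def by auto
      then have "ennreal (1 / K) * (ennreal K * ennreal (cut_powr s a t))
          \<le> ennreal (1 / K) * avg u \<omega> (ival L \<inter> {t<..}) (rearr L f) t"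
        by (rule mult_left_mono) simp
      then show ?thesis
        using K by (auto simp: indicator_def mult.assoc[symmetric] simp flip: ennreal_mult)
    qed simp
  qed
  also have "G = ennreal (1 / c) * (ennreal c * G)"
    using c by (simp add: mult.assoc[symmetric] flip: ennreal_mult)
  also have "ennreal (1 / K) * \<dots> \<le> ennreal (1 / K) * (ennreal (1 / c) * B_norm L p r b (rearr L f))"
    unfolding G_def using le[OF f] by (intro mult_left_mono) auto
  also have "B_norm L p r b (rearr L f) \<le> ennreal D * B1"
  proof -
    have "B_norm L p r b (rearr L f) \<le> B_norm L p r b (\<lambda>t. max (?g t) (ennreal (\<tau> powr (- a)) * indicator {0<..<1} t))"
    proof (rule B_norm_mono[OF b r rm])
      fix t assume t: "t \<in> ival L"
      have "max s t powr (- a) \<le> \<tau> powr (- a)" if "\<not> t < \<tau>"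
        using that \<tau> a(1) by (intro powr_mono2') auto
      then have "rearr L f t \<le> ?g t \<or> rearr L f t \<le> ennreal (\<tau> powr (- a)) * indicator {0<..<1} t"
        using ival_pos[OF t] \<tau>
        by (cases "t < \<tau>"; cases "t < 1") (simp_all add: rf[OF t] cut_powr_def ennreal_leI)
      then show "rearr L f t \<le> max (?g t) (ennreal (\<tau> powr (- a)) * indicator {0<..<1} t)"
        by (simp only: le_max_iff_disj)
    qed
    also have "\<dots> \<le> ennreal D * max B1 (B_norm L p r b (\<lambda>t. ennreal (\<tau> powr (- a)) * indicator {0<..<1} t))"
      unfolding D_def B1_def by (rule B_norm_max_le[OF b r gm im\<tau>])
    also have "max B1 (B_norm L p r b (\<lambda>t. ennreal (\<tau> powr (- a)) * indicator {0<..<1} t)) = B1"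
    proof (rule max_absorb1)
      have "B_norm L p r b (\<lambda>t. ennreal (\<tau> powr (- a)) * indicator {0<..<1} t) \<le> ennreal (\<tau> powr (- a)) * N"
        unfolding N_def by (rule B_norm_cmult_le[OF b r im])
      also have "\<dots> \<le> B1" using M s(3) by (simp add: B1_def)
      finally show "B_norm L p r b (\<lambda>t. ennreal (\<tau> powr (- a)) * indicator {0<..<1} t) \<le> B1" .
    qed
    finally show ?thesis .
  qed
  also have "ennreal (1 / K) * (ennreal (1 / c) * (ennreal D * B1)) = ennreal (1 / K * (1 / c) * D) * B1"
    using K c D by (intro ennreal_mult_assoc3) auto
  also have "1 / K * (1 / c) * D = 1 / 2"
    using D c by (simp add: K_def)
  finally have half: "B1 \<le> ennreal (1 / 2) * B1"
    by (simp add: mult_left_mono)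
  \<comment> \<open>Finiteness of \<open>B1\<close>: the cut bounds the function by its value
    \<open>s powr (- a)\<close>.\<close>
  have "B1 \<le> ennreal (s powr (- a)) * N"
    unfolding B1_def N_def
  proof (rule B_norm_le_cmult[OF b r gm im])
    fix t assume t: "t \<in> ival L"
    have "max s t powr (- a) \<le> s powr (- a)"
      using s a(1) by (intro powr_mono2') auto
    then show "?g t \<le> ennreal (s powr (- a)) * indicator {0<..<1} t"
      using \<tau> by (auto simp: indicator_def cut_powr_def intro: ennreal_leI)
  qed
  also have "\<dots> < \<infinity>" using N by (simp add: ennreal_mult_less_top)
  finally have "B1 = 0" using half by (intro ennreal_le_half_imp)
  then have "ennreal (\<tau> powr (- a)) * N = 0"
    using s(3) M by (simp add: B1_def)
  then show False using N \<tau> by simp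
qed

lemma equiv_onI:
  assumes "0 \<le> K" "0 \<le> K'" "\<And>f. f \<in> X \<Longrightarrow> F f \<le> ennreal K * G f" "\<And>f. f \<in> X \<Longrightarrow> G f \<le> ennreal K' * F f"
  shows "equiv_on X F G"
  unfolding equiv_on_def
proof (intro exI conjI ballI)
  \<comment> \<open>Adding 1 keeps \<open>c\<close> finite and positive when \<open>K' = 0\<close>;
    the maximum in \<open>C\<close> secures \<open>c \<le> C\<close>, which \<open>equiv_on\<close>
    requires.\<close>
  define c where "c = 1 / (K' + 1)"
  define C where "C = max K c"
  show c: "0 < c" "c \<le> C" using assms by (auto simp: c_def C_def)
  fix f assume f: "f \<in> X"
  have "ennreal c * G f \<le> ennreal c * (ennreal (K' + 1) * F f)"
    by (intro mult_left_mono order_trans[OF assms(4)[OF f]] mult_right_mono ennreal_leI) auto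
  also have "\<dots> = F f"
  proof -
    have "ennreal c * ennreal (K' + 1) = ennreal (c * (K' + 1))"
      using assms(2) c by (intro ennreal_mult[symmetric]) auto
    also have "c * (K' + 1) = 1"
      using assms(2) by (simp add: c_def)
    finally show ?thesis by (simp only: mult.assoc[symmetric] ennreal_1 mult_1_left)
  qed
  finally show "ennreal c * G f \<le> F f" .
  show "F f \<le> ennreal C * G f"
    using assms(3)[OF f] by (rule order_trans) (auto simp: C_def intro!: mult_right_mono ennreal_leI)
qed

theorem theorem39:
  fixes L p r U V W :: ennreal and b :: "real \<Rightarrow> real"
  assumes "L = 1 \<or> L = \<infinity>"
    and "0 < p" and "0 < r"
    and "b \<in> SV L"
    and "nontrivial_space L (LK_space L p r b)"
    and "0 < W" and "W < \<infinity>"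
    and "0 < U" and "U < \<infinity>"
    and "0 < V"
  shows "(equiv_on (meas_fun L) (LK_norm L p r b) (\<lambda>f. B_norm L p r b (H_upper L U W f))
            \<longleftrightarrow> U < p) \<and>
         (equiv_on (meas_fun L) (LK_norm L p r b) (\<lambda>f. B_norm L p r b (H_lower L V W f))
            \<longleftrightarrow> p < V)"
proof -
  have L: "1 \<le> L" using assms(1) by auto
  obtain \<omega> where \<omega>: "W = ennreal \<omega>" "0 < \<omega>"
    using assms(6,7) by (cases W) auto
  note b = assms(4) and r = assms(3)
  have u: "0 < recip U" using assms(8,9) by (rule recip_pos)
  have v: "0 \<le> recip V" by (rule recip_nonneg)
  have upper: "H_upper L U W f = (\<lambda>t. avg (recip U) \<omega> {0<..<t} (rearr L f) t)" for f
    using H_upper_eq_avg[OF \<omega>(2)] by (auto simp: \<omega>(1))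
  have lower: "H_lower L V W f = (\<lambda>t. avg (recip V) \<omega> (ival L \<inter> {t<..}) (rearr L f) t)" for f
    using H_lower_eq_avg[OF \<omega>(2)] by (auto simp: \<omega>(1))
  \<comment> \<open>Only the half of the equivalence that bounds the average by the norm of
    \<open>f\<close> is contradicted; the same holds for the lower average below.\<close>
  have "U < p" if eq: "equiv_on (meas_fun L) (LK_norm L p r b) (\<lambda>f. B_norm L p r b (H_upper L U W f))"
  proof (rule ccontr)
    assume "\<not> U < p"
    then have "recip U \<le> recip p"
      using recip_less_iff[OF assms(8,2)] by simp
    moreover obtain c where "0 < c" "\<And>f. f \<in> meas_fun L \<Longrightarrow>
        ennreal c * B_norm L p r b (H_upper L U W f) \<le> LK_norm L p r b f"
      using eq unfolding equiv_on_def by blast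
    ultimately show False
      using not_avg_upper_le[OF b L r \<omega>(2) u] unfolding upper LK_norm_def by blast
  qed
  moreover have "equiv_on (meas_fun L) (LK_norm L p r b) (\<lambda>f. B_norm L p r b (H_upper L U W f))" if "U < p"
  proof -
    have "recip p < recip U"
      using recip_less_iff[OF assms(8,2)] that by simp
    then obtain K where K: "0 \<le> K" "\<And>F. antimono F \<Longrightarrow>
        B_norm L p r b (\<lambda>t. avg (recip U) \<omega> {0<..<t} F t) \<le> ennreal K * B_norm L p r b F"
      using hardy_upper[OF b r \<omega>(2)] by blast
    define c where "c = (1 / (recip U * \<omega>)) powr (1 / \<omega>)"
    have c: "0 < c" using u \<omega> by (simp add: c_def)
    have "LK_norm L p r b f \<le> ennreal (1 / c) * B_norm L p r b (H_upper L U W f)" for f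
      unfolding upper LK_norm_def
    proof (rule B_norm_le_cmult[OF b r])
      fix t assume t: "t \<in> ival L"
      have "ennreal (1 / c) * (ennreal c * rearr L f t) \<le> ennreal (1 / c) * avg (recip U) \<omega> {0<..<t} (rearr L f) t"
        unfolding c_def by (intro mult_left_mono avg_upper_ge rearr_antimono \<omega> u ival_pos[OF t]) auto
      then show "rearr L f t \<le> ennreal (1 / c) * avg (recip U) \<omega> {0<..<t} (rearr L f) t"
        using c by (simp add: mult.assoc[symmetric] flip: ennreal_mult)
    qed (intro lebesgue_on_borel borel_measurable_antimono_ennreal rearr_antimono avg_upper_measurable \<omega>)+
    then show ?thesis
      using c K unfolding upper LK_norm_def
      by (intro equiv_onI[of "1 / c" K]) (auto intro: rearr_antimono)
  qed
  moreover have "p < V" if eq: "equiv_on (meas_fun L) (LK_norm L p r b) (\<lambda>f. B_norm L p r b (H_lower L V W f))"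
  proof (rule ccontr)
    assume "\<not> p < V"
    then have "recip p \<le> recip V"
      using recip_less_iff[OF assms(2,10)] by simp
    moreover obtain c where "0 < c" "\<And>f. f \<in> meas_fun L \<Longrightarrow>
        ennreal c * B_norm L p r b (H_lower L V W f) \<le> LK_norm L p r b f"
      using eq unfolding equiv_on_def by blast
    ultimately show False
      using not_avg_lower_le[OF b L r \<omega>(2) _ assms(5)] unfolding lower LK_norm_def by blast
  qed
  moreover have "equiv_on (meas_fun L) (LK_norm L p r b) (\<lambda>f. B_norm L p r b (H_lower L V W f))" if "p < V"
  proof -
    have "recip V < recip p"
      using recip_less_iff[OF assms(2,10)] that by simp
    then obtain K where K: "0 \<le> K" "\<And>F. antimono F \<Longrightarrow>
        B_norm L p r b (\<lambda>t. avg (recip V) \<omega> (ival L \<inter> {t<..}) F t) \<le> ennreal K * B_norm L p r b F"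
      using hardy_lower[OF b r \<omega>(2) v] by blast
    obtain K' where K': "0 \<le> K'" "\<And>F. antimono F \<Longrightarrow>
        B_norm L p r b F \<le> ennreal K' * B_norm L p r b (\<lambda>t. avg (recip V) \<omega> (ival L \<inter> {t<..}) F t)"
      using B_norm_le_avg_lower[OF b r \<omega>(2) v] by blast
    show ?thesis
      using K K' unfolding lower LK_norm_def
      by (intro equiv_onI[of K' K]) (auto intro: rearr_antimono)
  qed
  ultimately show ?thesis by blast
qed

end
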